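(* Let $\mathcal S(\mathbb Z_{25})$ denote the set of determinants of $25\times 25$ circulant matrices with integer entries. Then $\mathcal S(\mathbb Z_{25})$ consists exactly of: the integers coprime to $5$; all multiples of $5^4$; and all integers of the form $5^3qm$ where $m$ is an integer with $\gcd(m,5)=1$ and $q$ is a perissad.
   Context: For a prime $p$ and $k\geq1$ let $\omega_k=e^{2\pi i/p^k}$ and for $F\in\mathbb Z[x]$ let $N_k(F)=\prod_{1\leq j\leq p^k,\ p\nmid j}F(\omega_k^j)$ (an integer). Here $p=5$. A prime $q\equiv 1\pmod 5$ is called a perissad (Type 1) if there is $h\in\mathbb Z[x]$ with $5\nmid h(1)$ and $q=N_1(1+(x-1)^3h(x))$. The determinant of the circulant matrix with first row $(a_0,\dots,a_{n-1})$ equals $\prod_{z^n=1}F(z)$ with $F(x)=\sum a_jx^j$. *)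

theory Defs
  imports Complex_Main "HOL-Computational_Algebra.Polynomial" "Jordan_Normal_Form.Determinant"
begin

definition circulant :: "nat \<Rightarrow> (nat \<Rightarrow> int) \<Rightarrow> int mat" where
  "circulant n a = mat n n (\<lambda>(i, j). a ((j + n - i) mod n))"

definition circ_dets :: "nat \<Rightarrow> int set" where
  "circ_dets n = {d. \<exists>a. d = det (circulant n a)}"

definition Nnorm :: "nat \<Rightarrow> nat \<Rightarrow> int poly \<Rightarrow> complex" where
  "Nnorm p k F = (\<Prod>j\<in>{j\<in>{1..p^k}. \<not> p dvd j}.
      poly (map_poly of_int F) (cis (2 * pi * real j / real (p^k))))"

definition perissad :: "int \<Rightarrow> bool" where
  "perissad q \<longleftrightarrow> prime q \<and> q mod 5 = 1 \<and>
     (\<exists>h :: int poly. \<not> 5 dvd poly h 1 \<and>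
        of_int q = Nnorm 5 1 (1 + [:-1, 1:] ^ 3 * h))"

end

(* Evaluation at the 25th roots of unity gives det = F(1) N_1(F) N_2(F), and taking the norm from
   level 25 to level 5 first replaces F by an integer polynomial G = F + 5 H, so that
   G(1) = F(1) N_1(F) and N_2(F) = N_1(G).  If 5 divides the determinant then lambda = zeta - 1 divides
   both F(zeta) = lambda x and G(zeta) = lambda y in Z[zeta], zeta a fifth root of unity, and if
   moreover 5^4 does not, then 25 | G(1) forces y = x + lambda^3 e with e prime to lambda.

   Call x good if x = zeta^i conj(x) modulo lambda^4 for some i.  Conjugation acts on lambda^3 modulo
   lambda^4 as -1, so x and y are not both good.  Goodness is multiplicative; Z[zeta] is
   norm-Euclidean; a prime over q with q mod 5 in {2, 3, 4} is associated to its conjugate by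
   Frobenius and hence good, and a prime of norm q = 1 mod 5 is good unless q is a perissad.  So a
   perissad divides N(x) N(y).

   Conversely, 5^3 q m is the determinant of (X - 1) + Phi_5(X^5) v(X) with
   5 v(zeta) = lambda^4 h(zeta) and v(1) = m, after replacing h by a conjugate with
   h(1) = -m modulo 5. *)
theory Submission
  imports Defs "Jordan_Normal_Form.Char_Poly" "HOL-Number_Theory.Number_Theory"
begin

hide_const (open) up_ring.monom up_ring.coeff

text \<open>Why \<open>lam ^ 4\<close>: it is 5 times a unit, so passing from F to F + 5 H moves the
  value at \<open>zeta\<close> by a multiple of \<open>lam ^ 4\<close>, and cancelling the common
  factor \<open>lam\<close> leaves a shift by a multiple of \<open>lam ^ 3\<close>. The obstacle is
  the infinite unit group, since generators of an ideal are determined only up to units. Goodness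
  copes with it without a description of all units: a unit divided by its complex conjugate has
  absolute value 1 in every embedding, so it is plus or minus a power of \<open>zeta\<close>, and
  the sign is settled modulo \<open>lam\<close>. Every element prime to \<open>lam\<close> becomes 1
  modulo \<open>lam ^ 3\<close> after multiplication by a unit; one level further units cannot help,
  for they are all good and a shift by \<open>lam ^ 3 * e\<close> destroys goodness. The perissads
  are the primes that are norms of an element with a nonzero coefficient at exactly that level.
  Elements are kept as integer coordinate vectors, so that identities in Z[zeta] become polynomial
  identities over the integers.\<close>

datatype z5 = Z5 (c0: int) (c1: int) (c2: int) (c3: int)

lemma z5_eq_iff: "x = y \<longleftrightarrow> c0 x = c0 y \<and> c1 x = c1 y \<and> c2 x = c2 y \<and> c3 x = c3 y"
  by (cases x; cases y) auto

instantiation z5 :: comm_ring_1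
begin

definition zero_z5 where "0 = Z5 0 0 0 0"
definition one_z5 where "1 = Z5 1 0 0 0"
definition plus_z5 where "x + y = Z5 (c0 x + c0 y) (c1 x + c1 y) (c2 x + c2 y) (c3 x + c3 y)"
definition minus_z5 where "x - y = Z5 (c0 x - c0 y) (c1 x - c1 y) (c2 x - c2 y) (c3 x - c3 y)"
definition uminus_z5 where "- x = Z5 (- c0 x) (- c1 x) (- c2 x) (- c3 x)"
text \<open>\<open>p4\<close> is the coefficient of \<open>zeta ^ 4\<close>, which is eliminated by
  the vanishing of the fifth cyclotomic polynomial; the powers 5 and 6 wrap around to 0 and
  1.\<close>

definition times_z5 where "x * y =
  (let p4 = c1 x * c3 y + c2 x * c2 y + c3 x * c1 y in
   Z5 (c0 x * c0 y + c2 x * c3 y + c3 x * c2 y - p4)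
      (c0 x * c1 y + c1 x * c0 y + c3 x * c3 y - p4)
      (c0 x * c2 y + c1 x * c1 y + c2 x * c0 y - p4)
      (c0 x * c3 y + c1 x * c2 y + c2 x * c1 y + c3 x * c0 y - p4))"

lemmas z5_ops = zero_z5_def one_z5_def plus_z5_def minus_z5_def uminus_z5_def times_z5_def Let_def

instance
  by standard (simp_all add: z5_ops z5_eq_iff algebra_simps)

end

lemma z5_sel [simp]:
  "c0 0 = 0" "c1 0 = 0" "c2 0 = 0" "c3 0 = 0"
  "c0 1 = 1" "c1 1 = 0" "c2 1 = 0" "c3 1 = 0"
  "c0 (x + y) = c0 x + c0 y" "c1 (x + y) = c1 x + c1 y"
  "c2 (x + y) = c2 x + c2 y" "c3 (x + y) = c3 x + c3 y"
  "c0 (x - y) = c0 x - c0 y" "c1 (x - y) = c1 x - c1 y"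
  "c2 (x - y) = c2 x - c2 y" "c3 (x - y) = c3 x - c3 y"
  "c0 (- x) = - c0 x" "c1 (- x) = - c1 x" "c2 (- x) = - c2 x" "c3 (- x) = - c3 x"
  by (simp_all add: z5_ops)

lemma z5_sel_of_nat [simp]:
  "c0 (of_nat n) = of_nat n" "c1 (of_nat n) = 0" "c2 (of_nat n) = 0" "c3 (of_nat n) = 0"
  by (induction n) auto

lemma z5_sel_of_int [simp]:
  "c0 (of_int n) = n" "c1 (of_int n) = 0" "c2 (of_int n) = 0" "c3 (of_int n) = 0"
  by (cases n; simp)+

lemma z5_of_int: "of_int n = Z5 n 0 0 0"
  by (simp add: z5_eq_iff)

instance z5 :: ring_char_0
proof
  show "inj (of_nat :: nat \<Rightarrow> z5)"
    by (rule injI) (metis z5_sel_of_nat(1) of_nat_eq_iff)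
qed

definition zeta :: z5 where "zeta = Z5 0 1 0 0"

definition lam :: z5 where "lam = zeta - 1"

lemma z5_decomp: "x = of_int (c0 x) + of_int (c1 x) * zeta + of_int (c2 x) * zeta ^ 2 + of_int (c3 x) * zeta ^ 3"
  by (simp add: z5_eq_iff zeta_def z5_ops power2_eq_square power3_eq_cube)

lemma zeta_cyclotomic: "1 + zeta + zeta ^ 2 + zeta ^ 3 + zeta ^ 4 = 0"
  by (simp add: zeta_def z5_ops z5_eq_iff eval_nat_numeral)

lemma zeta_pow5 [simp]: "zeta ^ 5 = 1"
  by (simp add: zeta_def z5_ops z5_eq_iff eval_nat_numeral)

lemma z5_mult_of_int: "of_int n * x = Z5 (n * c0 x) (n * c1 x) (n * c2 x) (n * c3 x)"
  by (simp add: z5_of_int z5_ops)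

lemma of_int_dvd_z5: "of_int n dvd (x :: z5) \<longleftrightarrow> n dvd c0 x \<and> n dvd c1 x \<and> n dvd c2 x \<and> n dvd c3 x"
proof
  assume "of_int n dvd x"
  then show "n dvd c0 x \<and> n dvd c1 x \<and> n dvd c2 x \<and> n dvd c3 x"
    by (auto simp: dvd_def z5_mult_of_int)
next
  assume "n dvd c0 x \<and> n dvd c1 x \<and> n dvd c2 x \<and> n dvd c3 x"
  then obtain a b c d where "c0 x = n * a" "c1 x = n * b" "c2 x = n * c" "c3 x = n * d"
    by (auto simp: dvd_def)
  then have "x = of_int n * Z5 a b c d" by (simp add: z5_mult_of_int z5_eq_iff)
  then show "of_int n dvd x" by simp
qed

section \<open>Conjugation and norm\<close>

text \<open>The Galois automorphism sending \<open>zeta\<close> to \<open>zeta ^ 2\<close>. It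
  generates the cyclic Galois group of order 4, and its square \<open>bar\<close> is complex
  conjugation.\<close>

definition sig :: "z5 \<Rightarrow> z5" where
  "sig x = Z5 (c0 x - c2 x) (c3 x - c2 x) (c1 x - c2 x) (- c2 x)"

abbreviation bar :: "z5 \<Rightarrow> z5" where "bar x \<equiv> sig (sig x)"

interpretation sig: comm_ring_hom sig
  by unfold_locales (simp_all add: sig_def z5_ops algebra_simps)

lemma sig_zeta: "sig zeta = zeta ^ 2"
  by (simp add: sig_def zeta_def z5_ops power2_eq_square)

lemma sig_sig_sig_sig [simp]: "sig (sig (sig (sig x))) = x"
  by (simp add: sig_def z5_eq_iff)

text \<open>The field norm. With the fifth coordinate 0, \<open>r\<close> and \<open>s\<close>
  collect the products of coordinates at cyclic distance 1 and 2, so \<open>x * bar x\<close> is e -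
  r + (s - r) * (zeta^2 + zeta^3); the body multiplies this by its conjugate.\<close>

definition znorm :: "z5 \<Rightarrow> int" where
  "znorm x = (let a = c0 x; b = c1 x; c = c2 x; d = c3 x;
     e = a\<^sup>2 + b\<^sup>2 + c\<^sup>2 + d\<^sup>2; r = a * b + b * c + c * d; s = a * c + b * d + a * d
   in e\<^sup>2 - e * r - e * s - r\<^sup>2 - s\<^sup>2 + 3 * r * s)"

lemma mult_bar: "x * bar x = (let a = c0 x; b = c1 x; c = c2 x; d = c3 x;
     e = a\<^sup>2 + b\<^sup>2 + c\<^sup>2 + d\<^sup>2; r = a * b + b * c + c * d; s = a * c + b * d + a * d
   in Z5 (e - r) 0 (s - r) (s - r))"
  by (simp add: sig_def z5_ops algebra_simps power2_eq_square)

lemma norm_conj: "x * sig x * bar x * sig (bar x) = of_int (znorm x)"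
proof -
  have "x * sig x * bar x * sig (bar x) = (x * bar x) * sig (x * bar x)"
    by (simp add: sig.hom_mult mult_ac)
  also have "\<dots> = of_int (znorm x)"
  proof -
    have "Z5 (e - r) 0 (s - r) (s - r) * sig (Z5 (e - r) 0 (s - r) (s - r)) =
      Z5 (e\<^sup>2 - e * r - e * s - r\<^sup>2 - s\<^sup>2 + 3 * r * s) 0 0 0" for e r s
      by (simp add: sig_def z5_ops power2_eq_square algebra_simps)
    then show ?thesis unfolding mult_bar znorm_def z5_of_int Let_def .
  qed
  finally show ?thesis .
qed

lemma znorm_mult: "znorm (x * y) = znorm x * znorm y"
proof -
  have "of_int (znorm (x * y)) = (of_int (znorm x * znorm y) :: z5)"
    unfolding of_int_mult norm_conj[symmetric] by (simp add: sig.hom_mult mult_ac)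
  then show ?thesis by (simp only: of_int_eq_iff)
qed

lemma znorm_of_int: "znorm (of_int n) = n ^ 4"
  by (simp add: znorm_def Let_def eval_nat_numeral)

lemma znorm_sig [simp]: "znorm (sig x) = znorm x"
proof -
  have "of_int (znorm (sig x)) = (of_int (znorm x) :: z5)"
    unfolding norm_conj[symmetric] by (simp add: mult_ac)
  then show ?thesis by (simp only: of_int_eq_iff)
qed

lemma znorm_1 [simp]: "znorm 1 = 1" and znorm_0 [simp]: "znorm 0 = 0"
  by (simp_all add: znorm_def Let_def)

lemma dvd_znorm: "x dvd of_int (znorm x)"
  by (simp add: norm_conj[symmetric] mult.assoc)

text \<open>With \<open>P\<close> and \<open>Q\<close> the squared absolute values of the two pairs of complex conjugates of \<open>x\<close>,
  \<open>zq x = 2 * (P + Q)\<close> and \<open>P - Q\<close> is \<open>zt x\<close> times the square root of 5 (up to sign), while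
  \<open>znorm x = P * Q\<close>.\<close>

definition zq :: "z5 \<Rightarrow> int" where
  "zq x = (c0 x)\<^sup>2 + (c1 x)\<^sup>2 + (c2 x)\<^sup>2 + (c3 x)\<^sup>2
    + (c0 x - c1 x)\<^sup>2 + (c0 x - c2 x)\<^sup>2 + (c0 x - c3 x)\<^sup>2
    + (c1 x - c2 x)\<^sup>2 + (c1 x - c3 x)\<^sup>2 + (c2 x - c3 x)\<^sup>2"

definition zt :: "z5 \<Rightarrow> int" where
  "zt x = c0 x * c1 x + c1 x * c2 x + c2 x * c3 x - (c0 x * c2 x + c1 x * c3 x + c0 x * c3 x)"

lemma znorm_zq: "16 * znorm x = (zq x)\<^sup>2 - 20 * (zt x)\<^sup>2"
  by (simp add: znorm_def zq_def zt_def Let_def power2_eq_square algebra_simps)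

lemma zq_nonneg: "0 \<le> zq x"
  by (simp add: zq_def)

lemma znorm_le: "16 * znorm x \<le> (zq x)\<^sup>2"
  by (simp add: znorm_zq)

text \<open>Irrationality of the square root of 5: the exponent of 5 would be even on one side and
  odd on the other.\<close>

lemma sq_eq_5_sq: assumes "(s::int)\<^sup>2 = 5 * t\<^sup>2" shows "s = 0"
proof (rule ccontr)
  assume s: "s \<noteq> 0"
  then have t: "t \<noteq> 0" using assms by auto
  have p: "prime (5::int)" by simp
  have "multiplicity 5 (s\<^sup>2) = 2 * multiplicity 5 s" "multiplicity 5 (t\<^sup>2) = 2 * multiplicity 5 t"
    using s t p by (simp_all add: prime_elem_multiplicity_power_distrib)
  moreover have "multiplicity 5 (5 * t\<^sup>2) = Suc (multiplicity 5 (t\<^sup>2))"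
    using t by (simp add: multiplicity_times_same)
  ultimately have "2 * multiplicity 5 s = Suc (2 * multiplicity 5 t)"
    using assms by simp
  then show False by presburger
qed

text \<open>A vanishing norm makes \<open>zq x\<close> the square root of 5 times an integer, hence
  zero by irrationality, and \<open>zq\<close> is positive definite. This is what makes
  \<open>z5\<close> an integral domain.\<close>

lemma znorm_eq_0_iff [simp]: "znorm x = 0 \<longleftrightarrow> x = 0"
proof
  assume "znorm x = 0"
  then have "(zq x)\<^sup>2 = 5 * (2 * zt x)\<^sup>2"
    using znorm_zq[of x] by (simp add: power2_eq_square)
  then have "zq x = 0" by (rule sq_eq_5_sq)
  then have "(c0 x)\<^sup>2 = 0 \<and> (c1 x)\<^sup>2 = 0 \<and> (c2 x)\<^sup>2 = 0 \<and> (c3 x)\<^sup>2 = 0"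
    unfolding zq_def by (smt (verit) zero_le_power2)
  then show "x = 0" by (simp add: z5_eq_iff)
qed simp

instance z5 :: idom
proof
  fix x y :: z5
  assume "x \<noteq> 0" "y \<noteq> 0"
  then have "znorm (x * y) \<noteq> 0" by (simp add: znorm_mult)
  then show "x * y \<noteq> 0" by auto
qed

section \<open>Complex embeddings\<close>

definition emb :: "complex \<Rightarrow> z5 \<Rightarrow> complex" where
  "emb w x = of_int (c0 x) + of_int (c1 x) * w + of_int (c2 x) * w ^ 2 + of_int (c3 x) * w ^ 3"

lemma emb_hom:
  assumes "1 + w + w ^ 2 + w ^ 3 + w ^ 4 = 0"
  shows "comm_ring_hom (emb w)"
proof -
  have "emb w (x * y) = emb w x * emb w y" for x y
  proof -
    \<comment> \<open>The coefficients of w^4, w^5, w^6 in the unreduced product. Reducing each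
      power changes the value by a multiple of the cyclotomic polynomial, with cofactor 1, w - 1 and
      (w - 1) * w respectively.\<close>
    define p4 p5 p6 where "p4 = c1 x * c3 y + c2 x * c2 y + c3 x * c1 y"
      and "p5 = c2 x * c3 y + c3 x * c2 y" and "p6 = c3 x * c3 y"
    have "emb w x * emb w y - emb w (x * y) =
      (of_int p4 + of_int p5 * (w - 1) + of_int p6 * (w - 1) * w) * (1 + w + w ^ 2 + w ^ 3 + w ^ 4)"
      unfolding emb_def times_z5_def Let_def z5.sel p4_def p5_def p6_def
      by (simp add: eval_nat_numeral algebra_simps)
    then show ?thesis using assms by simp
  qed
  then show ?thesis
    by unfold_locales (simp_all add: emb_def algebra_simps)
qed

definition om :: complex where "om = cis (2 * pi / 5)"

lemma om_pow: "om ^ n = cis (2 * pi * real n / 5)"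
  by (simp add: om_def DeMoivre mult_ac)

lemma om_pow5 [simp]: "om ^ 5 = 1"
  by (simp add: om_pow)

lemma om_neq_1: "om \<noteq> 1"
proof
  assume "om = 1"
  then have "Re om = 1" by simp
  moreover have "cos (2 * pi / 5) < cos 0"
    by (rule cos_monotone_0_pi) (use pi_gt_zero in auto)
  ultimately show False by (simp add: om_def)
qed

lemma cyclotomic_root:
  fixes w :: complex
  assumes "w ^ 5 = 1" "w \<noteq> 1"
  shows "1 + w + w ^ 2 + w ^ 3 + w ^ 4 = 0"
proof -
  have "(w - 1) * (1 + w + w ^ 2 + w ^ 3 + w ^ 4) = w ^ 5 - 1"
    by (simp add: eval_nat_numeral algebra_simps)
  then show ?thesis using assms by simp
qed

lemma om_pow_mod: "om ^ n = om ^ (n mod 5)"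
proof -
  have "om ^ n = om ^ (5 * (n div 5) + n mod 5)" by simp
  also have "\<dots> = om ^ (n mod 5)" unfolding power_add power_mult by simp
  finally show ?thesis .
qed

lemma om_pow_neq_1:
  assumes "j \<in> {1, 2, 3, 4}"
  shows "om ^ j \<noteq> 1"
proof
  assume "om ^ j = 1"
  \<comment> \<open>By Fermat, j^3 is the inverse of j modulo 5.\<close>
  then have "om ^ (j * j ^ 3) = 1" by (simp add: power_mult)
  moreover have "j * j ^ 3 mod 5 = 1" using assms by auto
  ultimately show False using om_pow_mod[of "j * j ^ 3"] om_neq_1 by simp
qed

lemma om_pow_cyclotomic:
  assumes "j \<in> {1, 2, 3, 4}"
  shows "1 + om ^ j + (om ^ j) ^ 2 + (om ^ j) ^ 3 + (om ^ j) ^ 4 = 0"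
proof (rule cyclotomic_root)
  show "(om ^ j) ^ 5 = 1" by (metis om_pow5 power_commutes power_mult mult.commute power_one)
qed (rule om_pow_neq_1[OF assms])

lemma om_cyclotomic: "1 + om + om ^ 2 + om ^ 3 + om ^ 4 = 0"
  using om_pow_cyclotomic[of 1] by simp

lemmas emb_om = emb_hom[OF om_pow_cyclotomic]

lemma emb_zeta [simp]: "emb w zeta = w"
  by (simp add: emb_def zeta_def)

lemma emb_of_int [simp]: "emb w (of_int n) = of_int n"
  by (simp add: emb_def)

lemma emb_sig:
  assumes "1 + w + w ^ 2 + w ^ 3 + w ^ 4 = 0"
  shows "emb w (sig x) = emb (w ^ 2) x"
proof -
  have "emb w (sig x) - emb (w ^ 2) x =
    - (of_int (c2 x) + of_int (c3 x) * w * (w - 1)) * (1 + w + w ^ 2 + w ^ 3 + w ^ 4)"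
    unfolding emb_def sig_def z5.sel by (simp add: eval_nat_numeral algebra_simps)
  then show ?thesis using assms by simp
qed

lemma cnj_om: "cnj om = om ^ 4"
proof -
  have "cnj om * om = 1" by (simp add: om_def cis_cnj cis_mult)
  moreover have "om ^ 4 * om = 1" using om_pow5 by (simp add: eval_nat_numeral mult_ac)
  ultimately show ?thesis by (metis mult_right_cancel mult_zero_right zero_neq_one)
qed

lemma emb_conj:
  "emb om (sig x) = emb (om ^ 2) x" "emb om (bar x) = emb (om ^ 4) x"
  "emb om (sig (bar x)) = emb (om ^ 3) x"
proof -
  have 8: "om ^ 8 = om ^ 3" using om_pow_mod[of 8] by simp
  have c: "1 + om ^ 2 + (om ^ 2) ^ 2 + (om ^ 2) ^ 3 + (om ^ 2) ^ 4 = 0"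
    "1 + om ^ 4 + (om ^ 4) ^ 2 + (om ^ 4) ^ 3 + (om ^ 4) ^ 4 = 0"
    by (rule om_pow_cyclotomic; simp)+
  show "emb om (sig x) = emb (om ^ 2) x" "emb om (bar x) = emb (om ^ 4) x"
    "emb om (sig (bar x)) = emb (om ^ 3) x"
    using emb_sig[OF om_cyclotomic] emb_sig[OF c(1)] emb_sig[OF c(2)] 8
    by (simp_all flip: power_mult)
qed

lemma of_int_znorm:
  "of_int (znorm x) = emb om x * emb (om ^ 2) x * emb (om ^ 3) x * emb (om ^ 4) x"
proof -
  interpret comm_ring_hom "emb om" using emb_om[of 1] by simp
  have "of_int (znorm x) = emb om (x * sig x * bar x * sig (bar x))"
    by (simp add: norm_conj)
  then show ?thesis
    unfolding hom_mult emb_of_int unfolding emb_conj(3) unfolding emb_conj(2) unfolding emb_conj(1) by (simp only: mult_ac)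
qed

text \<open>The four embeddings form two complex conjugate pairs, so the norm is a product of two
  squared moduli.\<close>

lemma znorm_nonneg: "0 \<le> znorm x"
proof -
  have c: "emb (cnj w) x = cnj (emb w x)" for w
    by (simp add: emb_def)
  have "cnj (om ^ 2) = om ^ 3"
    using om_pow_mod[of 8] by (simp add: cnj_om flip: power_mult)
  then have "emb (om ^ 4) x = cnj (emb om x)" "emb (om ^ 3) x = cnj (emb (om ^ 2) x)"
    by (simp_all flip: c add: cnj_om)
  then have "complex_of_real (of_int (znorm x)) = of_real ((cmod (emb om x))\<^sup>2 * (cmod (emb (om ^ 2) x))\<^sup>2)"
    using of_int_znorm[of x] by (simp add: complex_norm_square mult_ac del: of_real_power)
  then have "real_of_int (znorm x) = (cmod (emb om x))\<^sup>2 * (cmod (emb (om ^ 2) x))\<^sup>2"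
    by (simp only: of_real_eq_iff)
  then have "real_of_int (znorm x) \<ge> 0" by simp
  then show ?thesis by simp
qed

lemma is_unit_z5_iff: "x dvd 1 \<longleftrightarrow> znorm x = 1"
proof
  assume "x dvd 1"
  then obtain y where "1 = x * y" by (elim dvdE)
  then have "znorm x * znorm y = 1" using znorm_mult znorm_1 by metis
  then show "znorm x = 1" using znorm_nonneg[of x] by (metis abs_of_nonneg zmult_eq_1_iff abs_minus_cancel abs_one)
next
  assume "znorm x = 1"
  then show "x dvd 1" using dvd_znorm[of x] by simp
qed

section \<open>Divisibility in the ring of integers\<close>

lemma div_nearest:
  fixes A n :: int
  assumes "n > 0"
  obtains q r where "A = n * q + r" "\<bar>2 * r\<bar> \<le> n"
proof
  let ?q = "(2 * A + n) div (2 * n)"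
  show "A = n * ?q + (A - n * ?q)" by simp
  have "2 * A + n = (2 * n) * ?q + (2 * A + n) mod (2 * n)" by simp
  moreover have "0 \<le> (2 * A + n) mod (2 * n)" "(2 * A + n) mod (2 * n) < 2 * n"
    using assms by (simp_all del: mult_mod_right)
  ultimately show "\<bar>2 * (A - n * ?q)\<bar> \<le> n" by (simp add: algebra_simps)
qed

text \<open>Here q rounds A / n to the nearest integer and p + 1/2 to the nearest half-integer. The
  absolute errors add up to 1/2, so their squares add up to at most 1/4.\<close>

lemma div_two_roundings:
  fixes A n :: int
  assumes "n > 0"
  obtains q p where "(2 * (A - n * q))\<^sup>2 + (2 * (A - n * p) - n)\<^sup>2 \<le> n\<^sup>2"
proof -
  obtain q r where q: "A = n * q + r" "\<bar>2 * r\<bar> \<le> n" using div_nearest[OF assms] .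
  show thesis
  proof (cases "r \<ge> 0")
    case True
    have "0 \<le> r * (n - 2 * r)" using True q(2) by simp
    then show thesis using q(1) by (intro that[of q q]) (simp add: power2_eq_square algebra_simps)
  next
    case False
    then have "0 \<le> (- r) * (n + 2 * r)" using q(2) by (intro mult_nonneg_nonneg) auto
    then show thesis using q(1) by (intro that[of q "q - 1"]) (simp add: power2_eq_square algebra_simps)
  qed
qed

text \<open>In barycentric coordinates (fifth coordinate 0) the form \<open>zq\<close> is invariant under a
  common shift; the second bound below is the first one after a shift by \<open>- n / 2\<close>.\<close>

lemma zq_le: "4 * zq x \<le> 5 * ((2 * c0 x)\<^sup>2 + (2 * c1 x)\<^sup>2 + (2 * c2 x)\<^sup>2 + (2 * c3 x)\<^sup>2)"
proof -
  have "5 * ((2 * c0 x)\<^sup>2 + (2 * c1 x)\<^sup>2 + (2 * c2 x)\<^sup>2 + (2 * c3 x)\<^sup>2) - 4 * zq x =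
    (2 * (c0 x + c1 x + c2 x + c3 x))\<^sup>2"
    by (simp add: zq_def power2_eq_square algebra_simps)
  then show ?thesis by (metis zero_le_power2 diff_ge_0_iff_ge)
qed

lemma zq_le_shift:
  "4 * zq x \<le> 5 * ((2 * c0 x - n)\<^sup>2 + (2 * c1 x - n)\<^sup>2 + (2 * c2 x - n)\<^sup>2 + (2 * c3 x - n)\<^sup>2 + n\<^sup>2)"
  (is "?l \<le> ?r")
proof -
  have "?r - ?l = (2 * (c0 x + c1 x + c2 x + c3 x) - 5 * n)\<^sup>2"
    by (simp add: zq_def power2_eq_square algebra_simps)
  then show ?thesis by (metis zero_le_power2 diff_ge_0_iff_ge)
qed

text \<open>Write a / b as \<open>A\<close> / n. By \<open>znorm_le\<close> a remainder of
  \<open>A\<close> modulo n with \<open>zq\<close> below 4 n^2 suffices. Two candidates are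
  compared, one with coordinates close to 0 and one with coordinates close to n / 2: their
  \<open>zq\<close> add up to at most 25/4 n^2, which is less than 8 n^2, so one of them
  succeeds.\<close>

lemma znorm_euclid:
  assumes "b \<noteq> 0"
  shows "\<exists>q. znorm (a - q * b) < znorm b"
proof -
  define n where "n = znorm b"
  have n: "n > 0" using assms znorm_nonneg[of b] unfolding n_def by (simp add: order_less_le)
  define b' where "b' = sig b * bar b * sig (bar b)"
  have bb: "b * b' = of_int n" using norm_conj[of b] by (simp add: b'_def n_def mult_ac)
  have nb: "znorm b' = n ^ 3" by (simp add: b'_def znorm_mult n_def eval_nat_numeral)
  define A where "A = a * b'"
  obtain q0 p0 where q0: "(2 * (c0 A - n * q0))\<^sup>2 + (2 * (c0 A - n * p0) - n)\<^sup>2 \<le> n\<^sup>2"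
    using div_two_roundings[OF n] .
  obtain q1 p1 where q1: "(2 * (c1 A - n * q1))\<^sup>2 + (2 * (c1 A - n * p1) - n)\<^sup>2 \<le> n\<^sup>2"
    using div_two_roundings[OF n] .
  obtain q2 p2 where q2: "(2 * (c2 A - n * q2))\<^sup>2 + (2 * (c2 A - n * p2) - n)\<^sup>2 \<le> n\<^sup>2"
    using div_two_roundings[OF n] .
  obtain q3 p3 where q3: "(2 * (c3 A - n * q3))\<^sup>2 + (2 * (c3 A - n * p3) - n)\<^sup>2 \<le> n\<^sup>2"
    using div_two_roundings[OF n] .
  define x where "x = A - of_int n * Z5 q0 q1 q2 q3"
  define y where "y = A - of_int n * Z5 p0 p1 p2 p3"
  have "4 * zq x + 4 * zq y \<le> 25 * n\<^sup>2"
    using zq_le[of x] zq_le_shift[of y n] q0 q1 q2 q3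
    by (simp add: x_def y_def z5_mult_of_int)
  moreover have "n\<^sup>2 > 0" using n by simp
  ultimately have "zq x < 4 * n\<^sup>2 \<or> zq y < 4 * n\<^sup>2" by linarith
  then obtain q where q: "zq (A - of_int n * q) < 4 * n\<^sup>2"
    unfolding x_def y_def by blast
  have "A - of_int n * q = (a - q * b) * b'"
    unfolding A_def bb[symmetric] by (simp add: algebra_simps)
  then have "16 * (znorm (a - q * b) * n ^ 3) \<le> (zq (A - of_int n * q))\<^sup>2"
    using znorm_le[of "A - of_int n * q"] by (simp add: znorm_mult nb)
  also have "\<dots> < (4 * n\<^sup>2)\<^sup>2"
    using q zq_nonneg by (intro power_strict_mono) auto
  also have "\<dots> = 16 * (n * n ^ 3)" by (simp add: eval_nat_numeral)
  finally have "znorm (a - q * b) < n" using n by simp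
  then show ?thesis unfolding n_def by blast
qed

text \<open>Division with remainder shows that a nonzero element of least norm in the ideal of
  \<open>a\<close> and \<open>b\<close> divides the whole ideal.\<close>

lemma z5_bezout: "\<exists>d x y. d = x * a + y * b \<and> d dvd a \<and> d dvd (b :: z5)"
proof (cases "a = 0 \<and> b = 0")
  case True
  then show ?thesis by auto
next
  case False
  define I where "I = {z. \<exists>x y. z = x * a + y * b}"
  have "1 * a + 0 * b \<in> I" "0 * a + 1 * b \<in> I" unfolding I_def by blast+
  then have ab: "a \<in> I" "b \<in> I" by simp_all
  have diff: "z - q * w \<in> I" if zw: "z \<in> I" "w \<in> I" for z w q
  proof -
    obtain x y x' y' where "z = x * a + y * b" "w = x' * a + y' * b" using zw unfolding I_def by blast
    then have "z - q * w = (x - q * x') * a + (y - q * y') * b" by (simp add: algebra_simps)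
    then show ?thesis unfolding I_def by blast
  qed
  from False ab have "\<exists>z. z \<in> I \<and> z \<noteq> 0" by blast
  then obtain d where d: "d \<in> I" "d \<noteq> 0"
    and least: "\<And>z. z \<in> I \<Longrightarrow> z \<noteq> 0 \<Longrightarrow> nat (znorm d) \<le> nat (znorm z)"
    using ex_has_least_nat[of "\<lambda>z. z \<in> I \<and> z \<noteq> 0" _ "\<lambda>z. nat (znorm z)"] by blast
  have "d dvd z" if z: "z \<in> I" for z
  proof -
    obtain q where q: "znorm (z - q * d) < znorm d" using znorm_euclid[OF d(2)] by blast
    have "z - q * d = 0"
    proof (rule ccontr)
      assume "z - q * d \<noteq> 0"
      from least[OF diff[OF z d(1)] this] q show False
        using znorm_nonneg[of "z - q * d"] by linarith
    qed
    then show ?thesis by simp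
  qed
  then show ?thesis using ab d(1) unfolding I_def by blast
qed

lemma znorm_dvd: "x dvd y \<Longrightarrow> znorm x dvd znorm y"
  by (auto simp: znorm_mult)

lemma prime_elem_z5I:
  assumes nz: "p \<noteq> 0" and nu: "\<not> p dvd 1"
    and irr: "\<And>d. d dvd p \<Longrightarrow> d dvd 1 \<or> p dvd d"
  shows "prime_elem (p :: z5)"
proof (rule prime_elemI)
  fix a b assume pab: "p dvd a * b"
  obtain d x y where d: "d = x * p + y * a" "d dvd p" "d dvd a" using z5_bezout by blast
  from irr[OF d(2)] show "p dvd a \<or> p dvd b"
  proof
    assume "d dvd 1"
    then obtain e where "1 = d * e" by (elim dvdE)
    then have "b = (x * p + y * a) * e * b" unfolding d(1)[symmetric] by simp
    also have "\<dots> = p * (x * e * b) + (a * b) * (y * e)" by (simp add: algebra_simps)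
    finally show ?thesis using pab by (metis dvd_add dvd_triv_left dvd_mult2)
  next
    assume "p dvd d"
    then show ?thesis using d(3) dvd_trans by blast
  qed
qed (use nz nu in auto)

text \<open>A nonunit divisor of least norm is irreducible, hence prime by Bezout.\<close>

lemma z5_prime_divisor:
  assumes "a \<noteq> 0" "\<not> a dvd 1"
  obtains p :: z5 where "prime_elem p" "p dvd a"
proof -
  have "a dvd a \<and> \<not> a dvd 1" using assms by simp
  then obtain p where p: "p dvd a" "\<not> p dvd 1"
    and least: "\<And>d. d dvd a \<Longrightarrow> \<not> d dvd 1 \<Longrightarrow> nat (znorm p) \<le> nat (znorm d)"
    using ex_has_least_nat[of "\<lambda>d. d dvd a \<and> \<not> d dvd 1" a "\<lambda>d. nat (znorm d)"] by metis
  have p0: "p \<noteq> 0" using p assms by auto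
  then have np: "znorm p > 0" using znorm_nonneg[of p] by (simp add: order_less_le)
  have "prime_elem p"
  proof (rule prime_elem_z5I[OF p0 p(2)])
    fix d assume d: "d dvd p"
    show "d dvd 1 \<or> p dvd d"
    proof (rule ccontr)
      assume neg: "\<not> (d dvd 1 \<or> p dvd d)"
      from d obtain e where e: "p = d * e" by (elim dvdE)
      have "\<not> e dvd 1"
      proof
        assume "e dvd 1"
        then obtain f where "1 = e * f" by (elim dvdE)
        then have "d = p * f" unfolding e by (simp add: mult.assoc)
        then show False using neg by simp
      qed
      then have "znorm e \<noteq> 1" "znorm d \<noteq> 1" using neg by (simp_all add: is_unit_z5_iff)
      moreover have "znorm p = znorm d * znorm e" unfolding e by (rule znorm_mult)
      moreover have "znorm p \<le> znorm d"
        using least[of d] d p(1) neg dvd_trans np znorm_nonneg[of d] by (auto simp: nat_le_eq_zle)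
      moreover have "znorm d > 0" "znorm e > 0"
        using np znorm_nonneg[of d] znorm_nonneg[of e] calculation(3)
        by (auto simp: zero_less_mult_iff)
      ultimately show False
        using mult_left_mono[of 2 "znorm e" "znorm d"] by simp
    qed
  qed
  then show thesis using p(1) that by blast
qed

section \<open>The prime above 5\<close>

text \<open>The value at 1 of the coordinate polynomial. Read modulo 5 it is the residue map onto
  Z[zeta] / lam, the field with 5 elements; only modulo 5 is it multiplicative.\<close>

definition eps :: "z5 \<Rightarrow> int" where
  "eps x = c0 x + c1 x + c2 x + c3 x"

lemma eps_simps [simp]:
  "eps (x + y) = eps x + eps y" "eps (x - y) = eps x - eps y" "eps (- x) = - eps x"
  "eps (of_int n) = n" "eps 0 = 0" "eps 1 = 1"
  by (simp_all add: eps_def)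

lemma eps_mult: "[eps (x * y) = eps x * eps y] (mod 5)"
proof -
  have "eps x * eps y - eps (x * y) = 5 * (c1 x * c3 y + c2 x * c2 y + c3 x * c1 y)"
    by (simp add: eps_def z5_ops algebra_simps)
  then show ?thesis by (metis cong_iff_dvd_diff cong_sym dvd_triv_left)
qed

lemma eps_power: "[eps (x ^ n) = eps x ^ n] (mod 5)"
  by (induction n) (auto intro!: cong_trans[OF eps_mult] cong_mult)

lemma eps_sig: "[eps (sig x) = eps x] (mod 5)"
proof -
  have "eps x - eps (sig x) = 5 * c2 x" by (simp add: eps_def sig_def)
  then show ?thesis by (metis cong_iff_dvd_diff cong_sym dvd_triv_left)
qed

text \<open>The quotient of \<open>lam ^ 4\<close> by 5: the signed binomial coefficients 1, -4, 6,
  -4, 1 differ from the cyclotomic coefficients 1, 1, 1, 1, 1 by multiples of 5.\<close>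

definition mu :: z5 where "mu = zeta ^ 2 - zeta - zeta ^ 3"

lemma lam_pow4: "lam ^ 4 = of_int 5 * mu"
  by (simp add: lam_def mu_def zeta_def z5_ops z5_eq_iff eval_nat_numeral z5_of_int)

lemma mu_unit: "mu dvd 1"
  unfolding is_unit_z5_iff by (simp add: mu_def zeta_def z5_ops eval_nat_numeral znorm_def)

lemma znorm_lam [simp]: "znorm lam = 5"
  by (simp add: lam_def zeta_def z5_ops znorm_def)

lemma lam_nz [simp]: "lam \<noteq> 0"
  by (simp add: lam_def zeta_def z5_ops)

lemma lam4_dvd_iff: "lam ^ 4 dvd x \<longleftrightarrow> of_int 5 dvd x"
  unfolding lam_pow4 using mu_unit by (rule mult_unit_dvd_iff)

lemma lam_dvd_5: "lam dvd of_int 5"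
proof -
  have "lam dvd lam ^ 4" by simp
  moreover have "lam ^ 4 dvd of_int 5" by (simp add: lam4_dvd_iff)
  ultimately show ?thesis by (rule dvd_trans)
qed

lemma lam_dvd_diff_eps: "lam dvd x - of_int (eps x)"
proof
  show "x - of_int (eps x) = lam * (of_int (c1 x) + of_int (c2 x) * (zeta + 1) + of_int (c3 x) * (zeta\<^sup>2 + zeta + 1))"
    by (simp add: lam_def zeta_def z5_of_int z5_ops z5_eq_iff eps_def power2_eq_square)
qed

lemma lam_dvd_iff: "lam dvd x \<longleftrightarrow> 5 dvd eps x"
proof
  assume "lam dvd x"
  then obtain y where "x = lam * y" by (elim dvdE)
  then have "[eps x = eps lam * eps y] (mod 5)" by (simp add: eps_mult)
  moreover have "eps lam = 0" by (simp add: eps_def lam_def zeta_def)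
  ultimately show "5 dvd eps x" by (simp add: cong_0_iff)
next
  assume "5 dvd eps x"
  then obtain k where "eps x = 5 * k" by (elim dvdE)
  then have "lam dvd of_int (eps x)" using lam_dvd_5 by (simp add: dvd_mult2)
  then show "lam dvd x" using lam_dvd_diff_eps[of x] dvd_add[of lam "x - of_int (eps x)" "of_int (eps x)"] by simp
qed

lemma lam_dvd_of_int_iff: "lam dvd of_int n \<longleftrightarrow> 5 dvd n"
  by (simp add: lam_dvd_iff)

lemma prime_elem_lam: "prime_elem lam"
proof (rule prime_elemI)
  fix a b assume "lam dvd a * b"
  then have "5 dvd eps a * eps b"
    unfolding lam_dvd_iff using cong_dvd_iff[OF eps_mult] by blast
  moreover have "prime (5 :: int)" by simp
  ultimately show "lam dvd a \<or> lam dvd b"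
    unfolding lam_dvd_iff by (simp only: prime_dvd_mult_iff)
qed (simp_all add: is_unit_z5_iff)

text \<open>Since 5 is totally ramified, all four conjugates have the same residue modulo
  \<open>lam\<close>.\<close>

lemma znorm_cong_eps: "[znorm x = eps x ^ 4] (mod 5)"
proof -
  have "[eps (x * sig x * bar x * sig (bar x)) = eps x * eps x * eps x * eps x] (mod 5)"
    by (intro cong_trans[OF eps_mult] cong_mult cong_refl cong_trans[OF eps_sig])
  moreover have "eps x * eps x * eps x * eps x = eps x ^ 4" by (simp add: eval_nat_numeral)
  ultimately show ?thesis unfolding norm_conj eps_simps by simp
qed

lemma dvd_znorm_iff: "5 dvd znorm x \<longleftrightarrow> lam dvd x"
proof -
  have "5 dvd znorm x \<longleftrightarrow> 5 dvd eps x ^ 4" by (rule cong_dvd_iff[OF znorm_cong_eps])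
  also have "\<dots> \<longleftrightarrow> 5 dvd eps x" by (rule prime_dvd_power_iff) simp_all
  finally show ?thesis by (simp add: lam_dvd_iff)
qed

lemma lam_dvd_zeta_pow: "lam dvd zeta ^ i - 1"
proof -
  have "[eps (zeta ^ i) = eps zeta ^ i] (mod 5)" by (rule eps_power)
  moreover have "eps zeta = 1" by (simp add: eps_def zeta_def)
  ultimately show ?thesis by (simp add: lam_dvd_iff cong_iff_dvd_diff)
qed

section \<open>The cubic residue class modulo units\<close>

lemma zeta_pows: "zeta ^ 0 = Z5 1 0 0 0" "zeta ^ 1 = Z5 0 1 0 0" "zeta ^ 2 = Z5 0 0 1 0"
  "zeta ^ 3 = Z5 0 0 0 1" "zeta ^ 4 = Z5 (- 1) (- 1) (- 1) (- 1)"
  by (simp_all add: zeta_def z5_ops eval_nat_numeral)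

text \<open>The hypothesis makes every embedding of \<open>x\<close> have absolute value 1. Then
  \<open>zq x = 4\<close>, and a sum of ten integer squares with this value leaves only finitely
  many coordinate vectors to inspect.\<close>

lemma bar_unit_cases:
  assumes "x * bar x = 1"
  shows "\<exists>i. x = zeta ^ i \<or> x = - (zeta ^ i)"
proof -
  have "zq x = 4 * c0 (x * bar x) - 2 * c2 (x * bar x)"
    unfolding mult_bar by (simp add: zq_def Let_def power2_eq_square algebra_simps)
  then have z: "zq x = 4" using assms by simp
  obtain a b c d where x: "x = Z5 a b c d" by (cases x)
  have z': "a\<^sup>2 + b\<^sup>2 + c\<^sup>2 + d\<^sup>2 + (a - b)\<^sup>2 + (a - c)\<^sup>2 + (a - d)\<^sup>2
    + (b - c)\<^sup>2 + (b - d)\<^sup>2 + (c - d)\<^sup>2 = 4"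
    using z by (simp add: zq_def x)
  have sq: "t\<^sup>2 < 4 \<Longrightarrow> t \<in> {-1, 0, 1}" for t :: int
  proof -
    assume "t\<^sup>2 < 4"
    then have "\<bar>t\<bar> < 2" using power2_less_imp_less[of "\<bar>t\<bar>" 2] by simp
    then show "t \<in> {-1, 0, 1}" by auto
  qed
  \<comment> \<open>Twice the left side is 3 s^2 + (2 t - s)^2, so s^2 is at most 8/3.\<close>
  have two: "s\<^sup>2 + t\<^sup>2 + (s - t)\<^sup>2 \<le> 4 \<Longrightarrow> s\<^sup>2 < 4" for s t :: int
  proof -
    assume "s\<^sup>2 + t\<^sup>2 + (s - t)\<^sup>2 \<le> 4"
    moreover have "0 \<le> (2 * t - s)\<^sup>2" by simp
    ultimately show "s\<^sup>2 < 4" by (simp add: power2_eq_square algebra_simps)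
  qed
  have nn: "0 \<le> t\<^sup>2" for t :: int by simp
  have "a\<^sup>2 < 4" using z' nn[of c] nn[of d] nn[of "a - c"] nn[of "a - d"] nn[of "b - c"] nn[of "b - d"] nn[of "c - d"]
    by (intro two[of a b]) linarith
  moreover have "b\<^sup>2 < 4" using z' nn[of a] nn[of d] nn[of "a - b"] nn[of "a - c"] nn[of "a - d"] nn[of "b - d"] nn[of "c - d"]
    by (intro two[of b c]) linarith
  moreover have "c\<^sup>2 < 4" using z' nn[of a] nn[of b] nn[of "a - b"] nn[of "a - c"] nn[of "a - d"] nn[of "b - d"] nn[of "b - c"]
    by (intro two[of c d]) linarith
  moreover have "d\<^sup>2 < 4" using z' nn[of c] nn[of b] nn[of "a - b"] nn[of "a - c"] nn[of "c - d"] nn[of "b - d"] nn[of "b - c"]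
      power2_commute[of d a]
    by (intro two[of d a]) linarith
  ultimately have mem: "a \<in> {-1,0,1}" "b \<in> {-1,0,1}" "c \<in> {-1,0,1}" "d \<in> {-1,0,1}"
    using sq by blast+
  from mem z' have "Z5 a b c d \<in> {Z5 1 0 0 0, Z5 0 1 0 0, Z5 0 0 1 0, Z5 0 0 0 1, Z5 (- 1) (- 1) (- 1) (- 1),
    Z5 (- 1) 0 0 0, Z5 0 (- 1) 0 0, Z5 0 0 (- 1) 0, Z5 0 0 0 (- 1), Z5 1 1 1 1}"
    unfolding insert_iff empty_iff simp_thms by (elim disjE) simp_all
  also have "\<dots> = {zeta ^ 0, zeta ^ 1, zeta ^ 2, zeta ^ 3, zeta ^ 4,
    - (zeta ^ 0), - (zeta ^ 1), - (zeta ^ 2), - (zeta ^ 3), - (zeta ^ 4)}"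
    unfolding zeta_pows by (simp add: uminus_z5_def)
  finally show ?thesis unfolding x by blast
qed

definition good :: "z5 \<Rightarrow> bool" where
  "good x \<longleftrightarrow> (\<exists>i. lam ^ 4 dvd x - zeta ^ i * bar x)"

lemma good_mult:
  assumes "good x" "good y"
  shows "good (x * y)"
proof -
  obtain i j where ij: "lam ^ 4 dvd x - zeta ^ i * bar x" "lam ^ 4 dvd y - zeta ^ j * bar y"
    using assms unfolding good_def by blast
  have "x * y - zeta ^ (i + j) * bar (x * y) =
    (x - zeta ^ i * bar x) * y + zeta ^ i * bar x * (y - zeta ^ j * bar y)"
    by (simp add: sig.hom_mult power_add algebra_simps)
  then have "lam ^ 4 dvd x * y - zeta ^ (i + j) * bar (x * y)"
    using ij by (simp add: dvd_mult dvd_mult2)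
  then show ?thesis unfolding good_def by blast
qed

text \<open>The quotient w of \<open>bar x\<close> by \<open>x\<close> satisfies
  \<open>w * bar w = 1\<close>, so it is plus or minus a power of \<open>zeta\<close>. Conjugation
  is trivial modulo \<open>lam\<close>, so the minus sign would give 2 x = 0 modulo
  \<open>lam\<close>. The congruence in \<open>good\<close> then even holds as an equality.\<close>

lemma good_if_dvd_bar:
  assumes "x dvd bar x" "\<not> lam dvd x"
  shows "good x"
proof -
  have x0: "x \<noteq> 0" using assms by auto
  from assms obtain w where w: "bar x = x * w" by (elim dvdE)
  have "x * 1 = bar (bar x)" by simp
  also have "\<dots> = x * w * bar w" by (simp only: w sig.hom_mult)
  finally have "x * 1 = x * (w * bar w)" by (simp only: mult.assoc)
  then have "w * bar w = 1" using x0 by simp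
  then obtain i where i: "w = zeta ^ i \<or> w = - (zeta ^ i)" using bar_unit_cases by blast
  \<comment> \<open>\<open>zeta ^ (4 * i)\<close> serves as the inverse of \<open>zeta ^ i\<close>,
    exponents being natural numbers.\<close>
  have z: "zeta ^ (4 * i) * zeta ^ i = 1"
  proof -
    have "zeta ^ (4 * i) * zeta ^ i = zeta ^ (5 * i)" by (simp flip: power_add)
    then show ?thesis by (simp add: power_mult)
  qed
  from i show ?thesis
  proof
    assume "w = zeta ^ i"
    then have "zeta ^ (4 * i) * bar x = x * (zeta ^ (4 * i) * zeta ^ i)" by (simp add: w mult_ac)
    then have "x - zeta ^ (4 * i) * bar x = 0" by (simp add: z)
    then show ?thesis unfolding good_def by (metis dvd_0_right)
  next
    assume "w = - (zeta ^ i)"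
    then have "bar x + x + x * (zeta ^ i - 1) = 0" by (simp add: w algebra_simps)
    then have "lam dvd bar x + x" using lam_dvd_zeta_pow[of i]
      by (metis dvd_0_right dvd_add_left_iff dvd_mult)
    then have "5 dvd eps (bar x) + eps x" by (simp add: lam_dvd_iff)
    moreover have "[eps (bar x) = eps x] (mod 5)" by (intro cong_trans[OF eps_sig] eps_sig)
    ultimately have "5 dvd eps x + eps x"
      by (metis cong_add_rcancel cong_dvd_iff)
    then have "lam dvd x" unfolding lam_dvd_iff by presburger
    with assms show ?thesis by simp
  qed
qed

lemma not_lam_dvd_unit: "u dvd 1 \<Longrightarrow> \<not> lam dvd u"
  by (metis dvd_trans prime_elem_lam prime_elem_not_unit)

lemma good_unit: "u dvd 1 \<Longrightarrow> good u"
  using good_if_dvd_bar[of u] not_lam_dvd_unit by (meson dvd_trans one_dvd)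

text \<open>Up to a unit the modulus is 5, which conjugation fixes, so \<open>x\<close> and
  \<open>bar x\<close> are both 1 modulo it.\<close>

lemma good_if_cong_1:
  assumes "lam ^ 4 dvd x - 1"
  shows "good x"
proof -
  from assms obtain k where k: "x - 1 = of_int 5 * k" unfolding lam4_dvd_iff by (elim dvdE)
  then have x: "x = of_int 5 * k + 1" by (metis diff_add_cancel)
  have "x - zeta ^ 0 * bar x = of_int 5 * (k - bar k)"
    unfolding x by (simp add: sig.hom_mult sig.hom_add sig.hom_of_int algebra_simps del: of_int_numeral)
  then show ?thesis unfolding good_def lam4_dvd_iff by (metis dvd_triv_left)
qed

text \<open>One step of lifting: modulo \<open>lam ^ Suc n\<close> the power \<open>w ^ j\<close> is
  1 + j * lam^n * k, so a suitable j cancels the coefficient of \<open>lam ^ n\<close> in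
  \<open>x - 1\<close>. It is applied with units \<open>w\<close>.\<close>

lemma unit_adjust:
  assumes n: "n \<ge> 1" and w: "w - 1 = lam ^ n * k" and k: "\<not> lam dvd k"
    and x: "lam ^ n dvd x - 1"
  shows "\<exists>j. lam ^ Suc n dvd w ^ j * x - 1"
proof -
  from x obtain b where b: "x - 1 = lam ^ n * b" by (elim dvdE)
  define L where "L = lam ^ n * k"
  have w': "w = 1 + L" using w by (simp add: L_def algebra_simps)
  have LL: "lam ^ Suc n dvd L * L"
  proof -
    have "lam ^ Suc n dvd lam ^ (n + n)" using n by (intro le_imp_power_dvd) simp
    then show ?thesis by (simp add: L_def power_add mult_ac)
  qed
  have wj: "lam ^ Suc n dvd w ^ j - 1 - of_nat j * L" for j
  proof (induction j)
    case (Suc j)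
    have "w ^ Suc j - 1 - of_nat (Suc j) * L = w * (w ^ j - 1 - of_nat j * L) + of_nat j * (L * L)"
      by (simp add: w' algebra_simps)
    then show ?case using Suc LL by (simp only: dvd_add dvd_mult)
  qed simp
  have "coprime (eps k) 5"
    using k prime_imp_coprime[of 5 "eps k"] by (simp add: lam_dvd_iff coprime_commute)
  then obtain y where y: "[eps k * y = 1] (mod 5)" using cong_solve_coprime_int by blast
  \<comment> \<open>Since \<open>y\<close> inverts \<open>eps k\<close> modulo 5, this j solves j *
    eps k + eps b = 0 modulo 5.\<close>
  define j where "j = nat ((- eps b * y) mod 5)"
  have "[int j = - eps b * y] (mod 5)" by (simp add: j_def cong_def)
  then have "[int j * eps k + eps b = (- eps b * y) * eps k + eps b] (mod 5)"
    by (intro cong_add cong_mult cong_refl)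
  also have "(- eps b * y) * eps k + eps b = eps b * (1 - eps k * y)" by (simp add: algebra_simps)
  also have "[\<dots> = eps b * (1 - 1)] (mod 5)" by (intro cong_mult cong_diff cong_refl y)
  finally have "5 dvd int j * eps k + eps b" by (simp add: cong_0_iff)
  moreover have "[eps (of_nat j * k) = int j * eps k] (mod 5)"
    using eps_mult[of "of_int (int j)" k] unfolding eps_simps by simp
  ultimately have "lam dvd of_nat j * k + b"
    unfolding lam_dvd_iff eps_simps by (metis cong_add_rcancel cong_dvd_iff)
  then have 1: "lam ^ Suc n dvd lam ^ n * (of_nat j * k + b)"
    by (simp add: mult.commute[of lam] mult_dvd_mono)
  have "w - 1 = L" by (simp add: w')
  have "L dvd w ^ j - 1"
    by (metis \<open>w - 1 = L\<close> one_power2 power_one dvd_refl power_diff_1_eq dvd_triv_left)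
  moreover have "lam ^ n dvd L" by (simp add: L_def)
  moreover have "lam dvd lam ^ n" using n by (simp add: dvd_power)
  ultimately have "lam dvd w ^ j - 1" by (meson dvd_trans)
  then have 2: "lam ^ Suc n dvd (w ^ j - 1) * (x - 1)"
    unfolding b by (simp add: mult_dvd_mono)
  have "w ^ j * x - 1 = (w ^ j - 1 - of_nat j * L) + lam ^ n * (of_nat j * k + b) + (w ^ j - 1) * (x - 1)"
    using b by (simp add: L_def algebra_simps)
  then have "lam ^ Suc n dvd w ^ j * x - 1"
    using wj[of j] 1 2 by (simp only: dvd_add)
  then show ?thesis by blast
qed

lemma znorm_power: "znorm (x ^ n) = znorm x ^ n"
  by (induction n) (simp_all add: znorm_mult)

text \<open>Three units fix the residue level by level: \<open>1 + zeta\<close> has residue 2, a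
  primitive root modulo 5; \<open>zeta\<close> is 1 + lam; and a power of the golden ratio differs
  from 1 by \<open>lam ^ 2\<close> times an element prime to \<open>lam\<close>. The fourth power is
  taken because the golden ratio itself has residue -2, of order 4.\<close>

lemma unit_normalize:
  assumes "\<not> lam dvd x"
  shows "\<exists>u. u dvd 1 \<and> lam ^ 3 dvd u * x - 1"
proof -
  have u1: "1 + zeta dvd 1" unfolding is_unit_z5_iff by (simp add: zeta_def z5_ops znorm_def)
  have "\<exists>k::nat. [2 ^ k * eps x = 1] (mod 5)"
  proof -
    have "eps x mod 5 \<in> {1, 2, 3, 4}"
      using assms unfolding lam_dvd_iff dvd_eq_mod_eq_0 by auto
    then consider "eps x mod 5 = 1" | "eps x mod 5 = 2" | "eps x mod 5 = 3" | "eps x mod 5 = 4" by blast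
    then show ?thesis
    proof cases
      case 1 then show ?thesis by (intro exI[of _ 0]) (simp add: cong_def)
    next
      case 2 then show ?thesis by (intro exI[of _ 3]) (simp add: cong_def, presburger)
    next
      case 3 then show ?thesis by (intro exI[of _ 1]) (simp add: cong_def, presburger)
    next
      case 4 then show ?thesis by (intro exI[of _ 2]) (simp add: cong_def, presburger)
    qed
  qed
  then obtain k :: nat where k: "[2 ^ k * eps x = 1] (mod 5)" by blast
  have "eps (1 + zeta) = 2" by (simp add: eps_def zeta_def)
  then have "[eps ((1 + zeta) ^ k * x) = 2 ^ k * eps x] (mod 5)"
    using eps_power[of "1 + zeta" k] by (metis cong_trans[OF eps_mult] cong_mult cong_refl)
  from cong_trans[OF this k] have "lam ^ 1 dvd (1 + zeta) ^ k * x - 1"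
    by (simp add: lam_dvd_iff cong_iff_dvd_diff)
  moreover have "zeta - 1 = lam ^ 1 * 1" by (simp add: lam_def)
  moreover have "\<not> lam dvd 1" by (simp add: lam_dvd_iff)
  ultimately obtain i where i: "lam ^ Suc 1 dvd zeta ^ i * ((1 + zeta) ^ k * x) - 1"
    using unit_adjust[of 1 zeta 1] by blast
  \<comment> \<open>the fourth power of the golden ratio \<open>- zeta ^ 2 - zeta ^ 3\<close>\<close>
  define v where "v = Z5 2 0 (- 3) (- 3)"
  have "v - 1 = lam ^ 2 * Z5 1 3 3 1"
    by (simp add: v_def lam_def zeta_def z5_ops power2_eq_square)
  moreover have "\<not> lam dvd Z5 1 3 3 1" by (simp add: lam_dvd_iff eps_def)
  moreover have "Suc 1 = 2" by simp
  ultimately obtain j where j: "lam ^ Suc 2 dvd v ^ j * (zeta ^ i * ((1 + zeta) ^ k * x)) - 1"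
    using unit_adjust[of 2 v "Z5 1 3 3 1"] i by (metis one_le_numeral)
  have "v dvd 1" unfolding is_unit_z5_iff by (simp add: v_def znorm_def)
  moreover have "zeta dvd 1" unfolding is_unit_z5_iff by (simp add: zeta_def znorm_def)
  ultimately have "v ^ j * zeta ^ i * (1 + zeta) ^ k dvd 1"
    using u1 unfolding is_unit_z5_iff by (simp add: znorm_mult znorm_power)
  moreover have "lam ^ 3 dvd (v ^ j * zeta ^ i * (1 + zeta) ^ k) * x - 1"
    using j by (simp add: mult.assoc numeral_3_eq_3)
  ultimately show ?thesis by blast
qed

section \<open>Prime elements\<close>

lemma freshman_dvd:
  fixes x y :: "'a :: comm_ring_1"
  assumes "prime q"
  shows "of_nat q dvd (x + y) ^ q - (x ^ q + y ^ q)"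
proof -
  have q: "q > 0" using assms by (rule prime_gt_0_nat)
  have "(x + y) ^ q = (\<Sum>k\<le>q. of_nat (q choose k) * x ^ k * y ^ (q - k))"
    by (rule binomial_ring)
  also have "{..q} = insert 0 (insert q {0<..<q})" using q by auto
  also have "(\<Sum>k\<in>insert 0 (insert q {0<..<q}). of_nat (q choose k) * x ^ k * y ^ (q - k)) =
      y ^ q + (x ^ q + (\<Sum>k\<in>{0<..<q}. of_nat (q choose k) * x ^ k * y ^ (q - k)))"
    using q by (subst sum.insert, simp, simp, subst sum.insert) auto
  finally have "(x + y) ^ q - (x ^ q + y ^ q) = (\<Sum>k\<in>{0<..<q}. of_nat (q choose k) * x ^ k * y ^ (q - k))"
    by simp
  moreover have "of_nat q dvd (of_nat (q choose k) :: 'a)" if "k \<in> {0<..<q}" for k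
  proof -
    have "q dvd q choose k" using assms that by (intro dvd_choose_prime) auto
    then show ?thesis by (metis dvd_def of_nat_mult)
  qed
  ultimately show ?thesis by (auto intro!: dvd_sum dvd_mult2)
qed

text \<open>The elements whose q-th power agrees with their image under \<open>f\<close> modulo q
  form a subring, by the binomial theorem; it contains \<open>zeta\<close>, hence
  everything.\<close>

lemma frobenius_z5:
  assumes f: "comm_ring_hom f" "f zeta = zeta ^ q" and q: "prime q"
  shows "of_nat q dvd x ^ q - f (x :: z5)"
proof -
  interpret f: comm_ring_hom f by fact
  define S where "S y \<longleftrightarrow> of_nat q dvd y ^ q - f y" for y
  have q0: "q > 0" using q by (rule prime_gt_0_nat)
  have add: "S (y + z)" if "S y" "S z" for y z
  proof -
    have "(y + z) ^ q - f (y + z) = ((y + z) ^ q - (y ^ q + z ^ q)) + ((y ^ q - f y) + (z ^ q - f z))"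
      by (simp add: f.hom_add algebra_simps)
    then show ?thesis using that freshman_dvd[OF q, of y z] unfolding S_def by (simp only: dvd_add)
  qed
  have mult: "S (y * z)" if "S y" "S z" for y z
  proof -
    have "(y * z) ^ q - f (y * z) = (y ^ q - f y) * z ^ q + f y * (z ^ q - f z)"
      by (simp add: f.hom_mult power_mult_distrib algebra_simps)
    then show ?thesis using that unfolding S_def by (simp only: dvd_add dvd_mult dvd_mult2)
  qed
  have uminus: "S (- y)" if "S y" for y
  proof -
    \<comment> \<open>Applying the binomial congruence to y + (-y) = 0 avoids a case split on the
      parity of q.\<close>
    have "of_nat q dvd y ^ q + (- y) ^ q"
      using freshman_dvd[OF q, of y "- y"] q0
      by (simp only: add.right_inverse zero_power diff_0 dvd_minus_iff)
    moreover have "(- y) ^ q - f (- y) = (y ^ q + (- y) ^ q) - (y ^ q - f y)"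
      by (simp add: f.hom_uminus)
    ultimately show ?thesis using that unfolding S_def by (simp only: dvd_diff)
  qed
  have one: "S 1" and zero: "S 0" using q0 by (simp_all add: S_def power_0_left)
  have "S (of_nat n)" for n by (induction n) (simp_all add: zero one add)
  then have int: "S (of_int n)" for n by (cases n rule: int_cases2) (simp_all add: uminus)
  have z: "S zeta" by (simp add: S_def f(2))
  have "S (of_int (c0 x) + of_int (c1 x) * zeta + of_int (c2 x) * zeta ^ 2 + of_int (c3 x) * zeta ^ 3)"
    unfolding power2_eq_square power3_eq_cube by (intro add mult int z)
  then show ?thesis unfolding S_def z5_decomp[of x, symmetric] .
qed

lemma zeta_pow_mod: "zeta ^ n = zeta ^ (n mod 5)"
proof -
  have "zeta ^ n = zeta ^ (5 * (n div 5) + n mod 5)" by simp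
  also have "\<dots> = zeta ^ (n mod 5)" unfolding power_add power_mult by simp
  finally show ?thesis .
qed

lemma sig_dvd_iff: "sig x dvd sig y \<longleftrightarrow> x dvd y"
proof
  assume "sig x dvd sig y"
  then obtain k where "sig y = sig x * k" by (elim dvdE)
  then have "sig (sig (sig (sig y))) = sig (sig (sig (sig x))) * sig (sig (sig k))"
    by (simp only: sig.hom_mult)
  then show "x dvd y" by simp
qed (auto simp: sig.hom_mult)

lemma prime_elem_sig:
  assumes "prime_elem x"
  shows "prime_elem (sig x)"
proof (rule prime_elemI)
  show "sig x \<noteq> 0" using assms by (metis prime_elem_not_zeroI znorm_eq_0_iff znorm_sig)
  show "\<not> sig x dvd 1" using prime_elem_not_unit[OF assms] unfolding is_unit_z5_iff znorm_sig .
  fix a b assume "sig x dvd a * b"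
  then have "sig x dvd sig (sig (sig (sig a)) * sig (sig (sig b)))" by (simp add: sig.hom_mult)
  then have "x dvd sig (sig (sig a)) * sig (sig (sig b))" unfolding sig_dvd_iff .
  then have "x dvd sig (sig (sig a)) \<or> x dvd sig (sig (sig b))"
    using assms prime_elem_dvd_multD by blast
  then show "sig x dvd a \<or> sig x dvd b"
    using sig_dvd_iff[of x "sig (sig (sig a))"] sig_dvd_iff[of x "sig (sig (sig b))"] by simp
qed

lemma prime_elem_over_prime:
  assumes "prime_elem (p :: z5)" "p dvd of_nat n" "n > 0"
  shows "\<exists>q. prime q \<and> p dvd of_nat q"
  using assms(2,3)
proof (induction n rule: less_induct)
  case (less n)
  have "n \<noteq> 1" using less.prems prime_elem_not_unit[OF assms(1)] by auto
  then obtain q where q: "prime q" "q dvd n" using prime_factor_nat by blast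
  then obtain m where m: "n = q * m" by (elim dvdE)
  with less.prems have "p dvd of_nat q * of_nat m" "m > 0" by auto
  then have "p dvd of_nat q \<or> p dvd of_nat m" using assms(1) prime_elem_dvd_multD by blast
  moreover have "m < n" using m less.prems q prime_gt_1_nat[of q] by simp
  ultimately show ?case using q less.IH[of m] \<open>m > 0\<close> by blast
qed

text \<open>A primitive root raised to the power (q - 1) / 5 has order 5 modulo q.\<close>

lemma cyclotomic_root_mod:
  assumes q: "prime q" "q mod 5 = 1"
  shows "\<exists>r::int. int q dvd r ^ 4 + r ^ 3 + r ^ 2 + r + 1"
proof -
  obtain g where g: "residue_primroot q g"
    using prime_primitive_root_exists[OF prime_gt_1_nat q(1)] q(1) by blast
  then have cop: "coprime q g" and ord: "ord q g = totient q" by (auto simp: residue_primroot_def)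
  have q1: "q > 1" using q(1) prime_gt_1_nat by blast
  define m where "m = (q - 1) div 5"
  have m: "q - 1 = 5 * m" using q(2) q1 unfolding m_def by presburger
  define r where "r = int (g ^ m)"
  have "[g ^ (5 * m) = 1] (mod q)"
    using ord q(1) m by (simp add: ord_divides' totient_prime)
  then have "[(g ^ m) ^ 5 = 1] (mod q)" by (simp add: mult.commute flip: power_mult)
  then have r5: "[r ^ 5 = 1] (mod int q)" unfolding r_def by (metis cong_int_iff of_nat_1 of_nat_power)
  have "\<not> [g ^ m = 1] (mod q)"
  proof
    assume "[g ^ m = 1] (mod q)"
    then have "5 * m dvd m" using ord q(1) m by (simp add: ord_divides' totient_prime)
    then show False using m q1 by (auto dest: dvd_imp_le)
  qed
  then have "\<not> int q dvd r - 1"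
    unfolding r_def cong_iff_dvd_diff[symmetric] by (metis cong_int_iff of_nat_1)
  moreover have "int q dvd (r - 1) * (r ^ 4 + r ^ 3 + r ^ 2 + r + 1)"
    using r5 by (simp add: cong_iff_dvd_diff eval_nat_numeral algebra_simps)
  moreover have "prime (int q)" using q(1) by simp
  ultimately show ?thesis using prime_dvd_multD by blast
qed

section \<open>Integer polynomials evaluated at \<open>zeta\<close>, and perissads as norms\<close>

abbreviation ieval :: "int poly \<Rightarrow> 'a :: comm_ring_1 \<Rightarrow> 'a" where
  "ieval F x \<equiv> poly (map_poly of_int F) x"

lemma (in comm_ring_hom) hom_ieval: "hom (ieval F x) = ieval F (hom x)"
  by (induction F) (simp_all add: map_poly_pCons hom_distribs)

lemma ieval_simps [simp]:
  "ieval (F + G) x = ieval F x + ieval G x" "ieval (F - G) x = ieval F x - ieval G x"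
  "ieval (F * G) x = ieval F x * ieval G x" "ieval (F ^ n) x = ieval F x ^ n"
  for x :: "'a :: comm_ring_1"
  by (simp_all add: of_int_hom.map_poly_hom_add of_int_poly_hom.hom_minus of_int_poly_hom.hom_mult of_int_poly_hom.hom_power)

lemma emb_ieval: "j \<in> {1, 2, 3, 4} \<Longrightarrow> emb (om ^ j) (ieval F zeta) = ieval F (om ^ j)"
  using comm_ring_hom.hom_ieval[OF emb_om, of j F zeta] by simp

lemma Nnorm_znorm: "Nnorm 5 1 F = of_int (znorm (ieval F zeta))"
proof -
  have "{j \<in> {1..5::nat}. \<not> 5 dvd j} = {1, 2, 3, 4}"
  proof -
    have "{1..5::nat} = {1, 2, 3, 4, 5}" by auto
    then show ?thesis by auto
  qed
  then have "Nnorm 5 1 F = (\<Prod>j\<in>{1, 2, 3, 4}. ieval F (om ^ j))"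
    unfolding Nnorm_def by (simp add: om_pow)
  also have "\<dots> = of_int (znorm (ieval F zeta))"
    unfolding of_int_znorm
    using emb_ieval[of 1 F] emb_ieval[of 2 F] emb_ieval[of 3 F] emb_ieval[of 4 F] by (simp add: mult_ac)
  finally show ?thesis .
qed

definition z5_poly :: "z5 \<Rightarrow> int poly" where
  "z5_poly x = [:c0 x, c1 x, c2 x, c3 x:]"

lemma ieval_z5_poly [simp]: "ieval (z5_poly x) zeta = x"
  by (simp add: z5_poly_def of_int_hom.map_poly_pCons_hom z5_eq_iff zeta_def z5_of_int z5_ops)

lemma poly_z5_poly_1: "poly (z5_poly x) 1 = eps x"
  by (simp add: z5_poly_def eps_def)

text \<open>The polynomial h of the definition is the coordinate polynomial of (x - 1) / lam^3, and
  its value at 1 is the residue of that quotient modulo \<open>lam\<close>.\<close>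

lemma perissadI:
  assumes q: "prime (znorm x)" and x: "lam ^ 3 dvd x - 1" "\<not> lam ^ 4 dvd x - 1"
  shows "perissad (znorm x)"
proof -
  from x(1) obtain b where b: "x - 1 = lam ^ 3 * b" by (elim dvdE)
  have "\<not> lam dvd b"
  proof
    assume "lam dvd b"
    then have "lam ^ 3 * lam dvd lam ^ 3 * b" by simp
    with x(2) b show False by (simp add: eval_nat_numeral mult_ac)
  qed
  then have "\<not> 5 dvd poly (z5_poly b) 1" by (simp add: poly_z5_poly_1 lam_dvd_iff)
  moreover have "ieval (1 + [:-1, 1:] ^ 3 * z5_poly b) zeta = x"
    using b by (simp add: map_poly_pCons lam_def algebra_simps)
  then have "of_int (znorm x) = Nnorm 5 1 (1 + [:-1, 1:] ^ 3 * z5_poly b)"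
    by (simp only: Nnorm_znorm)
  moreover have "znorm x mod 5 = 1"
  proof -
    have "lam dvd x - 1" using x(1) by (metis dvd_power dvd_trans zero_less_numeral)
    then have "[eps x = 1] (mod 5)" by (simp add: lam_dvd_iff cong_iff_dvd_diff)
    then have "[znorm x = 1 ^ 4] (mod 5)" by (metis cong_trans[OF znorm_cong_eps] cong_pow)
    then show ?thesis by (simp add: cong_def)
  qed
  ultimately show ?thesis unfolding perissad_def using q by blast
qed

text \<open>The rational prime q splits completely: the four conjugates of \<open>p\<close> divide q
  and are pairwise non-associated, so their product, the norm of \<open>p\<close>, divides q. To
  separate them, take a root r of the cyclotomic polynomial modulo q: \<open>p\<close> divides r -
  zeta^a for some a, and it cannot divide two of these, as their difference has norm 5.\<close>

lemma znorm_prime_split: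
  assumes p: "prime_elem p" and q: "prime q" "q mod 5 = 1" "p dvd of_nat q"
  shows "znorm p = int q"
proof -
  have p5: "\<not> p dvd of_int 5"
  proof
    assume "p dvd of_int 5"
    moreover have "coprime 5 (int q)"
      using q by (intro primes_coprime) auto
    then obtain x y where xy: "x * 5 + y * int q = 1" using bezout_int[of 5 "int q"] by auto
    have "of_int (x * 5 + y * int q) = (of_int x * of_int 5 + of_int y * of_nat q :: z5)" by simp
    then have "(1 :: z5) = of_int x * of_int 5 + of_int y * of_nat q" unfolding xy by simp
    ultimately have "p dvd 1" using q(3) by (metis dvd_add dvd_mult)
    with prime_elem_not_unit[OF p] show False ..
  qed
  from cyclotomic_root_mod[OF q(1,2)] obtain r :: int where r: "int q dvd r ^ 4 + r ^ 3 + r ^ 2 + r + 1" by blast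
  define y where "y = of_int r - zeta"
  have "znorm y = r ^ 4 + r ^ 3 + r ^ 2 + r + 1"
    by (simp add: y_def zeta_def znorm_def Let_def eval_nat_numeral algebra_simps)
  then obtain k where "znorm y = int q * k" using r by auto
  then have "p dvd of_int (znorm y)" using q(3) by (simp add: dvd_mult2)
  then have "p dvd y * sig y * bar y * sig (bar y)" by (simp only: norm_conj)
  then have "p dvd y \<or> p dvd sig y \<or> p dvd bar y \<or> p dvd sig (bar y)"
    using prime_elem_dvd_multD[OF p] by blast
  then obtain i where i: "p dvd (sig ^^ i) y"
    by (elim disjE; metis funpow_0 funpow_simps_right(2) comp_apply funpow.simps)
  have sp: "sig (zeta ^ n) = zeta ^ (2 * n)" for n
    by (simp add: sig.hom_power sig_zeta power_mult)
  have sy: "(sig ^^ i) y = of_int r - zeta ^ (2 ^ i)" for i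
    by (induction i) (simp_all add: y_def sig.hom_minus sig.hom_of_int sp)
  have nd: "\<not> p dvd (sig ^^ k) p" if k: "k \<in> {1, 2, 3}" for k
  proof
    assume a: "p dvd (sig ^^ k) p"
    have "(sig ^^ k) p dvd (sig ^^ k) ((sig ^^ i) y)"
      using i k by (auto simp: eval_nat_numeral sig_dvd_iff)
    with a have "p dvd (sig ^^ (k + i)) y" by (simp add: funpow_add) (rule dvd_trans)
    then have "p dvd (sig ^^ (k + i)) y - (sig ^^ i) y" using i by (rule dvd_diff)
    then have "p dvd zeta ^ (2 ^ i) - zeta ^ (2 ^ i * 2 ^ k)" by (simp add: sy power_add mult.commute)
    moreover have "(sig ^^ i) (zeta - zeta ^ (2 ^ k)) = zeta ^ (2 ^ i) - zeta ^ (2 ^ i * 2 ^ k)" for i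
      by (induction i) (simp_all add: sig.hom_minus sp mult_ac)
    ultimately have "p dvd (sig ^^ i) (zeta - zeta ^ (2 ^ k))" by simp
    then have "p dvd of_int (znorm ((sig ^^ i) (zeta - zeta ^ (2 ^ k))))" by (rule dvd_trans[OF _ dvd_znorm])
    moreover have "znorm ((sig ^^ i) x) = znorm x" for x by (induction i) simp_all
    moreover have "znorm (zeta - zeta ^ (2 ^ k)) = 5"
    proof -
      have "zeta ^ 8 = Z5 0 0 0 1"
      proof -
        have "(8::nat) mod 5 = 3" by simp
        then show ?thesis using zeta_pow_mod[of 8] zeta_pows(4) by argo
      qed
      moreover have "k = 1 \<or> k = 2 \<or> k = 3" using k by simp
      ultimately show ?thesis by (elim disjE) (simp_all add: zeta_pows znorm_def, simp_all add: zeta_def)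
    qed
    ultimately show False using p5 by simp
  qed
  have qs: "(of_nat q :: z5) = sig (of_nat q)" by (simp add: sig.hom_of_nat)
  have pr: "prime_elem p" "prime_elem (sig p)" "prime_elem (bar p)" "prime_elem (sig (bar p))"
    using p prime_elem_sig by blast+
  have dq: "sig p dvd of_nat q" "bar p dvd of_nat q" "sig (bar p) dvd of_nat q"
    using q(3) by (metis sig_dvd_iff qs)+
  have nd': "\<not> p dvd sig p" "\<not> p dvd bar p" "\<not> p dvd sig (bar p)"
    using nd[of 1] nd[of 2] nd[of 3] by (simp_all add: eval_nat_numeral)
  have step: "a * b dvd n" if "prime_elem b" "\<not> b dvd a" "a dvd n" "b dvd n" for a b n :: z5
  proof -
    from that(3) obtain c where c: "n = a * c" by (elim dvdE)
    have "b dvd a \<or> b dvd c" using that(4) unfolding c by (rule prime_elem_dvd_multD[OF that(1)])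
    then show ?thesis unfolding c using that(2) by (simp add: mult_dvd_mono)
  qed
  have "sig (bar p) * bar p dvd of_nat q"
    using step[OF pr(3) _ dq(3,2)] nd'(1) by (metis sig_dvd_iff)
  then have "sig (bar p) * bar p * sig p dvd of_nat q"
    using step[OF pr(2) _ _ dq(1)] nd'(1,2) prime_elem_dvd_multD[OF pr(2)] by (metis sig_dvd_iff)
  then have "sig (bar p) * bar p * sig p * p dvd of_nat q"
    using step[OF pr(1) _ _ q(3)] nd' prime_elem_dvd_multD[OF pr(1)] by metis
  also have "sig (bar p) * bar p * sig p * p = of_int (znorm p)"
    unfolding norm_conj[symmetric] by (simp only: mult_ac)
  finally have "of_int (znorm p) dvd (of_int (int q) :: z5)" by simp
  then have "znorm p dvd int q" unfolding of_int_dvd_z5 by simp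
  moreover have "znorm p \<noteq> 1" using prime_elem_not_unit[OF p] by (simp add: is_unit_z5_iff)
  moreover have "prime (int q)" using q(1) by simp
  ultimately show ?thesis using znorm_nonneg[of p] by (metis prime_int_iff)
qed

text \<open>Let q be the rational prime below \<open>p\<close>. By Frobenius \<open>p\<close>
  divides its image under the automorphism sending \<open>zeta\<close> to \<open>zeta ^ q\<close>.
  For q = 2 or 3 modulo 5, applying that automorphism twice gives conjugation, since 4 and 9 are -1
  modulo 5; for q = 4 it is conjugation already. In these cases \<open>p\<close> divides
  \<open>bar p\<close>.\<close>

lemma good_prime:
  assumes p: "prime_elem p" and l: "\<not> lam dvd p"
  shows "good p \<or> perissad (znorm p)"
proof -
  have "p \<noteq> 0" using l by auto
  then have "znorm p > 0" using znorm_nonneg[of p] by (simp add: order_less_le)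
  moreover from this have "p dvd of_nat (nat (znorm p))" using dvd_znorm[of p] by (simp add: of_nat_nat)
  ultimately have "\<exists>q. prime q \<and> p dvd of_nat q"
    by (intro prime_elem_over_prime[OF p, of "nat (znorm p)"]) simp_all
  then obtain q where q: "prime q" "p dvd of_nat q" by (elim exE conjE)
  have q5: "q \<noteq> 5"
  proof
    assume "q = 5"
    then have "p dvd lam ^ 4" using q(2) by (simp add: lam_pow4 dvd_mult2)
    then have "p dvd lam" by (rule prime_elem_dvd_power[OF p])
    then obtain w where w: "lam = p * w" by (elim dvdE)
    then have "lam dvd p * w" by simp
    then have "lam dvd w" using l prime_elem_dvd_multD[OF prime_elem_lam] by blast
    then obtain t where "w = lam * t" by (elim dvdE)
    then have "lam * 1 = lam * (p * t)" using w by (simp add: mult_ac)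
    then have "p * t = 1" by simp
    then have "p dvd 1" by (metis dvd_triv_left)
    with prime_elem_not_unit[OF p] show False ..
  qed
  have pp: "p dvd p ^ q" using prime_gt_0_nat[OF q(1)] by (simp add: dvd_power)
  have frob: "p dvd f p" if "comm_ring_hom f" "f zeta = zeta ^ q" for f
  proof -
    have "p dvd p ^ q - f p" by (rule dvd_trans[OF q(2) frobenius_z5[OF that q(1)]])
    then have "p dvd p ^ q - (p ^ q - f p)" using pp by (rule dvd_diff[rotated])
    then show ?thesis by simp
  qed
  have "\<not> 5 dvd q" using q5 q(1) by (auto simp: prime_nat_iff)
  then have "q mod 5 = 1 \<or> q mod 5 = 2 \<or> q mod 5 = 3 \<or> q mod 5 = 4" by presburger
  then consider "q mod 5 = 1" | "q mod 5 = 2" | "q mod 5 = 3" | "q mod 5 = 4" by blast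
  then show ?thesis
  proof cases
    case 1
    have n: "znorm p = int q" by (rule znorm_prime_split[OF p q(1) 1 q(2)])
    obtain u where u: "u dvd 1" "lam ^ 3 dvd u * p - 1" using unit_normalize[OF l] by blast
    have nu: "znorm (u * p) = int q" using n u(1) by (simp add: znorm_mult is_unit_z5_iff)
    \<comment> \<open>After normalization by a unit, \<open>p\<close> is either 1 modulo
      \<open>lam ^ 4\<close>, hence good, or it has a nonzero coefficient at \<open>lam ^ 3\<close>,
      which is what makes its norm a perissad.\<close>
    show ?thesis
    proof (cases "lam ^ 4 dvd u * p - 1")
      case True
      then have "good (u * p)" by (rule good_if_cong_1)
      moreover from u(1) obtain v where v: "1 = u * v" by (elim dvdE)
      then have "good v" by (metis good_unit dvd_triv_right)
      ultimately have "good (v * (u * p))" using good_mult by blast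
      also have "v * (u * p) = (u * v) * p" by (simp add: mult_ac)
      finally show ?thesis by (simp flip: v)
    next
      case False
      then show ?thesis using perissadI[of "u * p"] u(2) q(1) nu n by simp
    qed
  next
    case 2
    have "comm_ring_hom sig" ..
    then have "p dvd sig p" by (rule frob) (use 2 zeta_pow_mod[of q] in \<open>simp add: sig_zeta\<close>)
    moreover from this have "sig p dvd bar p" by (simp only: sig_dvd_iff)
    ultimately have "p dvd bar p" by (rule dvd_trans)
    then show ?thesis using good_if_dvd_bar l by blast
  next
    case 3
    have "comm_ring_hom (\<lambda>x. sig (bar x))"
      by unfold_locales (simp_all add: sig.hom_mult sig.hom_add)
    then have "p dvd sig (bar p)"
      by (rule frob) (use 3 zeta_pow_mod[of q] zeta_pow_mod[of 8] in \<open>simp add: sig_zeta sig.hom_power flip: power_mult\<close>)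
    moreover from this have "sig (bar p) dvd bar p"
      using sig_dvd_iff[of p "sig (bar p)"] sig_dvd_iff[of "sig p" "bar (bar p)"]
        sig_dvd_iff[of "bar p" "sig (bar (bar p))"] by simp
    ultimately have "p dvd bar p" by (rule dvd_trans)
    then show ?thesis using good_if_dvd_bar l by blast
  next
    case 4
    have "comm_ring_hom (\<lambda>x. bar x)"
      by unfold_locales (simp_all add: sig.hom_mult sig.hom_add)
    then have "p dvd bar p"
      by (rule frob) (use 4 zeta_pow_mod[of q] in \<open>simp add: sig_zeta sig.hom_power flip: power_mult\<close>)
    then show ?thesis using good_if_dvd_bar l by blast
  qed
qed

lemma good_if_no_perissad:
  assumes "\<not> lam dvd x" "\<And>q. perissad q \<Longrightarrow> \<not> q dvd znorm x"
  shows "good x"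
  using assms
proof (induction "nat (znorm x)" arbitrary: x rule: less_induct)
  case less
  show ?case
  proof (cases "x dvd 1")
    case True
    then show ?thesis by (rule good_unit)
  next
    case False
    have "x \<noteq> 0" using less.prems by auto
    with False obtain p where p: "prime_elem p" "p dvd x" using z5_prime_divisor by blast
    from p(2) obtain y where y: "x = p * y" by (elim dvdE)
    have l: "\<not> lam dvd p" "\<not> lam dvd y" using less.prems(1) by (auto simp: y)
    have n: "znorm x = znorm p * znorm y" by (simp add: y znorm_mult)
    have "p \<noteq> 0" "y \<noteq> 0" using l by auto
    then have pos: "znorm p > 0" "znorm y > 0"
      using znorm_nonneg[of p] znorm_nonneg[of y] by (simp_all add: order_less_le)
    moreover have "znorm p \<noteq> 1" using prime_elem_not_unit[OF p(1)] by (simp add: is_unit_z5_iff)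
    ultimately have "znorm y < znorm x" unfolding n by simp
    then have "good y"
      using less.hyps[of y] l(2) less.prems(2) pos unfolding n by (simp, metis dvd_mult)
    moreover have "good p"
      using good_prime[OF p(1) l(1)] less.prems(2)[of "znorm p"] by (auto simp: n)
    ultimately show ?thesis unfolding y by (rule good_mult[rotated])
  qed
qed

text \<open>The residue of \<open>x\<close> modulo \<open>lam ^ 4\<close> and units is moved by \<open>lam ^ 3 * e\<close>: conjugation
  fixes the residue of a good element but acts on \<open>lam ^ 3 * e\<close> modulo \<open>lam ^ 4\<close> as \<open>-1\<close>.\<close>

lemma not_good_shift:
  assumes x: "\<not> lam dvd x" and e: "\<not> lam dvd e" and g: "good x" "good (x + lam ^ 3 * e)"
  shows False
proof -
  obtain i where i: "lam ^ 4 dvd x - zeta ^ i * bar x" using g(1) unfolding good_def by blast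
  obtain j where j: "lam ^ 4 dvd (x + lam ^ 3 * e) - zeta ^ j * bar (x + lam ^ 3 * e)"
    using g(2) unfolding good_def by blast
  \<comment> \<open>Conjugation multiplies \<open>lam\<close> by this unit, which is -1 modulo
    \<open>lam\<close>; its cube is the source of the sign -1 at level 3.\<close>
  define s where "s = - (zeta ^ 4)"
  have s: "bar lam = lam * s"
    by (simp add: s_def lam_def sig_def zeta_def z5_ops eval_nat_numeral)
  have bl: "bar (lam ^ 3 * e) = lam ^ 3 * (s ^ 3 * bar e)"
    unfolding sig.hom_mult sig.hom_power s by (simp add: power_mult_distrib mult_ac)
  have "lam ^ 3 dvd lam ^ 4" by (simp add: le_imp_power_dvd)
  then have "lam ^ 3 dvd (x + lam ^ 3 * e) - zeta ^ j * bar (x + lam ^ 3 * e) - (x - zeta ^ i * bar x)"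
    using i j by (meson dvd_diff dvd_trans)
  also have "\<dots> = (zeta ^ i - zeta ^ j) * bar x + lam ^ 3 * (e - zeta ^ j * (s ^ 3 * bar e))"
    unfolding sig.hom_add bl by (simp add: algebra_simps)
  finally have d: "lam ^ 3 dvd (zeta ^ i - zeta ^ j) * bar x"
    by (simp only: dvd_add_left_iff[OF dvd_triv_left])
  \<comment> \<open>Modulo \<open>lam ^ 3\<close> the shift is invisible, so both congruences must
    use the same power of \<open>zeta\<close>: distinct powers differ by an element of norm 5,
    whereas \<open>lam ^ 3\<close> has norm 125.\<close>
  have zij: "zeta ^ i = zeta ^ j"
  proof (rule ccontr)
    assume ne: "zeta ^ i \<noteq> zeta ^ j"
    have "i mod 5 \<in> {0, 1, 2, 3, 4}" "j mod 5 \<in> {0, 1, 2, 3, 4}" by auto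
    with ne have "znorm (zeta ^ i - zeta ^ j) = 5"
      unfolding zeta_pow_mod[of i] zeta_pow_mod[of j]
      by (elim insertE emptyE; simp only: zeta_pows; simp add: znorm_def)
    with znorm_dvd[OF d] have "125 dvd 5 * znorm x" by (simp add: znorm_mult znorm_power)
    then have "5 dvd znorm x" by presburger
    with x show False by (simp add: dvd_znorm_iff)
  qed
  have "lam ^ 4 dvd (x + lam ^ 3 * e) - zeta ^ j * bar (x + lam ^ 3 * e) - (x - zeta ^ i * bar x)"
    using i j by (rule dvd_diff[rotated])
  also have "\<dots> = lam ^ 3 * (e - zeta ^ j * (s ^ 3 * bar e))"
    unfolding sig.hom_add bl zij by (simp add: algebra_simps)
  also have "lam ^ 4 = lam ^ 3 * lam" by (simp add: eval_nat_numeral)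
  finally have "lam dvd e - zeta ^ j * (s ^ 3 * bar e)" by simp
  then have "[eps e = eps (zeta ^ j * (s ^ 3 * bar e))] (mod 5)"
    by (simp add: lam_dvd_iff cong_iff_dvd_diff)
  also have "[eps (zeta ^ j * (s ^ 3 * bar e)) = 1 * (4 ^ 3 * eps e)] (mod 5)"
  proof (intro cong_trans[OF eps_mult] cong_mult)
    show "[eps (zeta ^ j) = 1] (mod 5)"
      using lam_dvd_zeta_pow[of j] by (simp add: lam_dvd_iff cong_iff_dvd_diff)
    have "eps s = 4" by (simp add: s_def eps_def zeta_pows)
    then show "[eps (s ^ 3) = 4 ^ 3] (mod 5)" using eps_power[of s 3] by simp
    show "[eps (bar e) = eps e] (mod 5)" by (intro cong_trans[OF eps_sig] eps_sig)
  qed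
  finally have "5 dvd eps e - 64 * eps e" unfolding cong_iff_dvd_diff by simp
  then obtain k where "eps e - 64 * eps e = 5 * k" by (elim dvdE)
  \<comment> \<open>This inverts 63 modulo 5: 2 * 63 = 126 = 5 * 25 + 1.\<close>
  then have "eps e = 5 * (- 2 * k - 25 * eps e)" by simp
  then have "5 dvd eps e" by (rule dvdI)
  with e show False by (simp add: lam_dvd_iff)
qed

section \<open>Circulant determinants as products over roots of unity\<close>

lemma root_unity_pow: "cis (2 * pi / real n) ^ k = cis (2 * pi * real k / real n)"
  by (simp add: DeMoivre mult_ac)

lemma root_unity_orthogonal:
  assumes "n > 0" "i < n" "l < n"
  defines "w \<equiv> cis (2 * pi / real n)"
  shows "(\<Sum>k<n. w ^ (i * k) * cnj (w ^ (k * l))) = (if i = l then of_nat n else 0)"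
proof -
  define x where "x = w ^ i * cnj (w ^ l)"
  have un: "w ^ k * cnj (w ^ k) = 1" for k
    by (simp add: w_def root_unity_pow cis_cnj cis_mult)
  have wn: "w ^ n = 1" using assms(1) by (simp add: w_def root_unity_pow)
  have eq: "w ^ (i * k) * cnj (w ^ (k * l)) = x ^ k" for k
    by (simp add: x_def power_mult_distrib mult.commute[of k l] flip: power_mult)
  show ?thesis
  proof (cases "i = l")
    case True
    then have "x = 1" using un[of l] by (simp add: x_def)
    then show ?thesis unfolding eq using True by simp
  next
    case False
    have "x \<noteq> 1"
    proof
      assume "x = 1"
      have "w ^ i = w ^ i * (w ^ l * cnj (w ^ l))" unfolding un by simp
      also have "\<dots> = w ^ l * x" by (simp only: x_def mult_ac)
      finally have "w ^ i = w ^ l" using \<open>x = 1\<close> by simp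
      moreover have "inj_on (\<lambda>k. w ^ k) {..<n}"
        using bij_betw_roots_unity[OF assms(1)] unfolding w_def root_unity_pow bij_betw_def by blast
      ultimately show False using False assms(2,3) by (auto dest: inj_onD)
    qed
    moreover have "x ^ n = 1"
    proof -
      have "x ^ n = (w ^ n) ^ i * cnj ((w ^ n) ^ l)"
        by (simp add: x_def power_mult_distrib mult.commute flip: power_mult)
      then show ?thesis by (simp add: wn)
    qed
    ultimately have "(\<Sum>k<n. x ^ k) = 0" using geometric_sum[of x n] by simp
    then show ?thesis unfolding eq using False by simp
  qed
qed

lemma sum_mod_shift:
  fixes f :: "nat \<Rightarrow> 'a :: comm_monoid_add"
  assumes "i < n"
  shows "(\<Sum>j<n. f ((j + n - i) mod n)) = (\<Sum>k<n. f k)"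
proof (rule sum.reindex_bij_witness[of _ "\<lambda>k. (k + i) mod n" "\<lambda>j. (j + n - i) mod n"])
  fix j assume "j \<in> {..<n}"
  then have j: "j < n" by simp
  show "((j + n - i) mod n + i) mod n = j"
    using j assms by (simp add: mod_add_left_eq)
next
  fix k assume "k \<in> {..<n}"
  then have k: "k < n" by simp
  show "((k + i) mod n + n - i) mod n = k"
  proof (cases "k + i < n")
    case True
    then show ?thesis using k by simp
  next
    case False
    then have "(k + i) mod n = k + i - n" using k assms by (simp add: mod_if)
    then show ?thesis using k False assms by simp
  qed
qed (use assms in auto)

text \<open>The Fourier matrix \<open>V\<close> consists of eigenvectors,
  \<open>C * V = V * D\<close>, and it is invertible because its product with its entrywise
  conjugate \<open>V'\<close> is n times the identity.\<close>

lemma det_circulant: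
  assumes n: "n > 0"
  defines "w \<equiv> cis (2 * pi / real n)"
  shows "of_int (det (circulant n a)) = (\<Prod>l<n. \<Sum>k<n. of_int (a k) * (w ^ l) ^ k)"
proof -
  define C :: "complex mat" where "C = map_mat of_int (circulant n a)"
  define V where "V = mat n n (\<lambda>(j, l). w ^ (j * l))"
  define V' where "V' = mat n n (\<lambda>(j, l). cnj (w ^ (j * l)))"
  define ev where "ev l = (\<Sum>k<n. of_int (a k) * (w ^ l) ^ k)" for l
  define D where "D = mat n n (\<lambda>(i, j). if i = j then ev i else 0)"
  have carrier: "C \<in> carrier_mat n n" "V \<in> carrier_mat n n" "V' \<in> carrier_mat n n" "D \<in> carrier_mat n n"
    by (simp_all add: C_def V_def V'_def D_def circulant_def)
  have wn: "w ^ n = 1" using n by (simp add: w_def root_unity_pow)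
  have wmod: "w ^ (k mod n) = w ^ k" for k
  proof -
    have "w ^ k = w ^ (n * (k div n) + k mod n)" by simp
    also have "\<dots> = w ^ (k mod n)" unfolding power_add power_mult wn by simp
    finally show ?thesis by simp
  qed
  have "V * V' = of_nat n \<cdot>\<^sub>m 1\<^sub>m n"
  proof (rule eq_matI)
    fix i l assume "i < dim_row (of_nat n \<cdot>\<^sub>m 1\<^sub>m n :: complex mat)" "l < dim_col (of_nat n \<cdot>\<^sub>m 1\<^sub>m n :: complex mat)"
    then have il: "i < n" "l < n" by simp_all
    then have "(V * V') $$ (i, l) = (\<Sum>k<n. w ^ (i * k) * cnj (w ^ (k * l)))"
      by (simp add: V_def V'_def scalar_prod_def atLeast0LessThan)
    then show "(V * V') $$ (i, l) = (of_nat n \<cdot>\<^sub>m 1\<^sub>m n) $$ (i, l)"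
      using root_unity_orthogonal[OF n il] il unfolding w_def[symmetric] by simp
  qed (simp_all add: V_def V'_def)
  then have "det V * det V' = of_nat n ^ n"
    using det_mult[OF carrier(2,3)] by (simp add: det_smult)
  then have dV: "det V \<noteq> 0" using n by auto
  have "C * V = V * D"
  proof (rule eq_matI)
    fix i l assume "i < dim_row (V * D)" "l < dim_col (V * D)"
    then have il: "i < n" "l < n" by (simp_all add: V_def D_def)
    have "(C * V) $$ (i, l) = (\<Sum>j<n. of_int (a ((j + n - i) mod n)) * w ^ (j * l))"
      using il by (simp add: C_def circulant_def V_def scalar_prod_def atLeast0LessThan)
    also have "\<dots> = (\<Sum>j<n. of_int (a ((j + n - i) mod n)) * (w ^ l) ^ ((j + n - i) mod n) * w ^ (i * l))"
    proof (intro sum.cong refl)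
      fix j assume "j \<in> {..<n}"
      have "(w ^ l) ^ ((j + n - i) mod n) * w ^ (i * l) = (w ^ ((j + n - i) mod n)) ^ l * (w ^ i) ^ l"
        by (simp add: mult.commute flip: power_mult)
      also have "\<dots> = (w ^ (j + n - i) * w ^ i) ^ l" by (simp add: wmod power_mult_distrib)
      also have "w ^ (j + n - i) * w ^ i = w ^ (j + n)" using il by (simp flip: power_add)
      also have "\<dots> = w ^ j" by (simp add: power_add wn)
      finally show "of_int (a ((j + n - i) mod n)) * w ^ (j * l) =
        of_int (a ((j + n - i) mod n)) * (w ^ l) ^ ((j + n - i) mod n) * w ^ (i * l)"
        by (simp add: mult.assoc flip: power_mult)
    qed
    also have "\<dots> = ev l * w ^ (i * l)"
      unfolding ev_def sum_distrib_right[symmetric]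
      using sum_mod_shift[OF il(1), of "\<lambda>k. of_int (a k) * (w ^ l) ^ k"] by simp
    also have "\<dots> = (\<Sum>k<n. w ^ (i * k) * (if k = l then ev k else 0))"
      using il by (simp add: sum.delta' if_distrib[of "\<lambda>x. _ * x"] cong: if_cong)
    also have "\<dots> = (V * D) $$ (i, l)"
      using il by (simp add: V_def D_def scalar_prod_def atLeast0LessThan)
    finally show "(C * V) $$ (i, l) = (V * D) $$ (i, l)" .
  qed (simp_all add: C_def circulant_def V_def D_def)
  then have "det (C * V) = det (V * D)" by (rule arg_cong)
  then have "det C * det V = det V * det D"
    unfolding det_mult[OF carrier(1,2)] det_mult[OF carrier(2,4)] .
  then have "det C = det D" using dV by simp
  also have "det D = (\<Prod>l<n. ev l)"
  proof -
    have "upper_triangular D" by (auto simp: D_def)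
    then have "det D = prod_list (diag_mat D)" by (rule det_upper_triangular[OF _ carrier(4)])
    also have "diag_mat D = map ev [0..<n]" by (simp add: diag_mat_def D_def)
    finally show ?thesis by (simp add: prod.list_conv_set_nth atLeast0LessThan)
  qed
  also have "det C = of_int (det (circulant n a))" by (simp add: C_def of_int_hom.hom_det)
  finally show ?thesis by (simp add: ev_def)
qed

lemma ieval_reduce:
  assumes "n > 0"
  shows "\<exists>a. \<forall>z :: complex. z ^ n = 1 \<longrightarrow> ieval F z = (\<Sum>k<n. of_int (a k) * z ^ k)"
proof (induction F)
  case 0
  show ?case by (intro exI[of _ "\<lambda>_. 0"]) simp
next
  case (pCons c F)
  then obtain a where a: "\<And>z :: complex. z ^ n = 1 \<Longrightarrow> ieval F z = (\<Sum>k<n. of_int (a k) * z ^ k)" by blast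
  obtain m where m: "n = Suc m" using assms by (cases n) auto
  \<comment> \<open>Modulo z^n = 1, multiplication by z rotates the coefficients, so the top one
    wraps around to the constant term.\<close>
  define b where "b k = (if k = 0 then c + a m else a (k - 1))" for k
  have "ieval (pCons c F) z = (\<Sum>k<n. of_int (b k) * z ^ k)" if z: "z ^ n = 1" for z :: complex
  proof -
    have "(\<Sum>k<n. of_int (b k) * z ^ k) = of_int c + of_int (a m) + (\<Sum>k<m. of_int (a k) * z ^ Suc k)"
      unfolding m sum.lessThan_Suc_shift by (simp add: b_def)
    also have "\<dots> = of_int c + of_int (a m) * z ^ n + z * (\<Sum>k<m. of_int (a k) * z ^ k)"
      unfolding z by (simp add: sum_distrib_left mult_ac)
    also have "\<dots> = of_int c + z * (\<Sum>k<n. of_int (a k) * z ^ k)"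
      by (simp add: m algebra_simps)
    finally show ?thesis using a[OF z] by (simp add: of_int_hom.map_poly_pCons_hom)
  qed
  then show ?case by blast
qed

lemma circ_dets_iff:
  assumes "n > 0"
  shows "d \<in> circ_dets n \<longleftrightarrow> (\<exists>F. of_int d = (\<Prod>l<n. ieval F (cis (2 * pi / real n) ^ l)))"
proof
  assume "d \<in> circ_dets n"
  then obtain a where d: "d = det (circulant n a)" unfolding circ_dets_def by blast
  define F where "F = (\<Sum>k<n. monom (a k) k)"
  have "ieval F z = (\<Sum>k<n. of_int (a k) * z ^ k)" for z :: complex
    by (simp add: F_def of_int_poly_hom.hom_sum poly_sum poly_monom)
  then have "of_int d = (\<Prod>l<n. ieval F (cis (2 * pi / real n) ^ l))"
    unfolding d det_circulant[OF assms] by simp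
  then show "\<exists>F. of_int d = (\<Prod>l<n. ieval F (cis (2 * pi / real n) ^ l))" by blast
next
  assume "\<exists>F. of_int d = (\<Prod>l<n. ieval F (cis (2 * pi / real n) ^ l))"
  then obtain F where F: "of_int d = (\<Prod>l<n. ieval F (cis (2 * pi / real n) ^ l))" by blast
  obtain a where a: "\<And>z :: complex. z ^ n = 1 \<Longrightarrow> ieval F z = (\<Sum>k<n. of_int (a k) * z ^ k)"
    using ieval_reduce[OF assms] by blast
  have "(cis (2 * pi / real n) ^ l) ^ n = 1" for l
    using assms by (simp add: DeMoivre flip: power_mult) (metis cis_multiple_2pi Ints_of_nat mult.assoc mult.commute)
  then have "of_int d = (of_int (det (circulant n a)) :: complex)"
    unfolding F det_circulant[OF assms] by (simp only: a)
  then have "d = det (circulant n a)" by simp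
  then show "d \<in> circ_dets n" unfolding circ_dets_def by blast
qed

section \<open>The 25th roots of unity\<close>

definition eta :: complex where "eta = cis (2 * pi / 25)"

lemma eta_pow5: "eta ^ 5 = om"
  by (simp add: eta_def om_def DeMoivre)

lemma eta_pow_mod: "eta ^ n = eta ^ (n mod 25)"
proof -
  have "eta ^ 25 = (eta ^ 5) ^ 5" by (simp flip: power_mult)
  then have e: "eta ^ 25 = 1" by (simp add: eta_pow5)
  have "eta ^ n = eta ^ (25 * (n div 25) + n mod 25)" by simp
  also have "\<dots> = eta ^ (n mod 25)" unfolding power_add power_mult e by simp
  finally show ?thesis .
qed

lemma prod_25_blocks: "(\<Prod>j<25. g j) = (\<Prod>i<5. \<Prod>t<5. g (i + 5 * t))"
  for g :: "nat \<Rightarrow> 'a :: comm_monoid_mult"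
  by (simp add: lessThan_nat_numeral lessThan_Suc mult_ac)

text \<open>The roots are grouped by their fifth power: for fixed \<open>i\<close> the inner product
  runs over the fifth roots of \<open>om ^ i\<close>.\<close>

lemma circ_dets_25_iff:
  "d \<in> circ_dets 25 \<longleftrightarrow> (\<exists>F. of_int d = (\<Prod>i<5. \<Prod>t<5. ieval F (om ^ t * eta ^ i)))"
proof -
  have "(\<Prod>l<25. ieval F (eta ^ l)) = (\<Prod>i<5. \<Prod>t<5. ieval F (om ^ t * eta ^ i))" for F
    unfolding prod_25_blocks eta_pow5[symmetric] by (simp add: power_add mult.commute flip: power_mult)
  then show ?thesis using circ_dets_iff[of 25 d] by (simp add: eta_def)
qed

section \<open>The norm polynomial\<close>

lemma int_pow5_cong: "5 dvd (a::int) ^ 5 - a"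
proof -
  have "a mod 5 \<in> {0, 1, 2, 3, 4}" by auto
  then have "(a mod 5) ^ 5 mod 5 = a mod 5" by auto
  then show ?thesis by (simp add: power_mod mod_eq_dvd_iff)
qed

lemma pow5_cong: "[:5:] dvd F ^ 5 - F \<circ>\<^sub>p monom 1 5" for F :: "int poly"
proof (induction F)
  case (pCons a F)
  define x :: "int poly" where "x = monom 1 1"
  have x5: "monom 1 5 = x ^ 5" by (simp add: x_def monom_power)
  have pc: "pCons a F = [:a:] + x * F" by (simp add: x_def monom_Suc monom_0)
  have comp: "pCons a F \<circ>\<^sub>p monom 1 5 = [:a:] + x ^ 5 * (F \<circ>\<^sub>p monom 1 5)"
    by (simp add: pcompose_pCons x5)
  have "of_nat 5 dvd ([:a:] + x * F) ^ 5 - ([:a:] ^ 5 + (x * F) ^ 5)"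
    by (rule freshman_dvd) simp
  then have 1: "[:5:] dvd ([:a:] + x * F) ^ 5 - ([:a:] ^ 5 + (x * F) ^ 5)"
    by (simp add: numeral_poly)
  have "[:a:] ^ 5 - [:a:] = [:a ^ 5 - a:]" by (simp add: poly_const_pow)
  then have 2: "[:5:] dvd [:a:] ^ 5 - [:a:]" using int_pow5_cong[of a] by simp
  have "pCons a F ^ 5 - pCons a F \<circ>\<^sub>p monom 1 5 =
    (([:a:] + x * F) ^ 5 - ([:a:] ^ 5 + (x * F) ^ 5)) + ([:a:] ^ 5 - [:a:])
    + x ^ 5 * (F ^ 5 - F \<circ>\<^sub>p monom 1 5)"
    unfolding comp unfolding pc by (simp add: power_mult_distrib algebra_simps)
  then show ?case using 1 2 pCons.IH by (simp only: dvd_add dvd_mult)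
qed simp

lemma coeff_pcompose_monom5:
  fixes F :: "'a :: comm_ring_1 poly"
  shows "coeff (F \<circ>\<^sub>p monom 1 5) n = (if 5 dvd n then coeff F (n div 5) else 0)"
proof (induction F arbitrary: n)
  case (pCons a F)
  have c: "coeff (pCons a F \<circ>\<^sub>p monom 1 5) n =
    (if n = 0 then a else 0) + (if n < 5 then 0 else coeff (F \<circ>\<^sub>p monom 1 5) (n - 5))"
    by (simp add: pcompose_pCons coeff_monom_mult coeff_pCons split: nat.split)
  consider "n = 0" | "0 < n" "n < 5" | "5 \<le> n" by linarith
  then show ?case
  proof cases
    case 1
    then show ?thesis unfolding c by simp
  next
    case 2
    then show ?thesis unfolding c by (auto dest: dvd_imp_le)
  next
    case 3
    have "5 dvd n - 5 \<longleftrightarrow> 5 dvd n" using 3 by (metis dvd_diffD dvd_diff_nat dvd_refl)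
    moreover have "n div 5 = Suc ((n - 5) div 5)" using 3 by (simp add: le_div_geq)
    ultimately show ?thesis using 3 pCons.IH[of "n - 5"] unfolding c by simp
  qed
qed simp

lemma dvd_prod_diff_power:
  fixes A :: "nat \<Rightarrow> 'a :: comm_ring_1"
  assumes "\<And>t. d dvd A t - B"
  shows "d dvd (\<Prod>t<n. A t) - B ^ n"
proof (induction n)
  case (Suc n)
  have "(\<Prod>t<Suc n. A t) - B ^ Suc n = ((\<Prod>t<n. A t) - B ^ n) * A n + B ^ n * (A n - B)"
    by (simp add: algebra_simps)
  then show ?case using Suc assms by (simp only: dvd_add dvd_mult dvd_mult2)
qed simp

lemma ieval_hom_poly:
  assumes "comm_ring_hom f"
  shows "map_poly f (map_poly of_int F) = map_poly of_int F"
proof -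
  interpret comm_ring_hom f by fact
  show ?thesis by (intro poly_eqI) (simp add: hom_of_int)
qed

lemma pcompose_scale:
  "(F \<circ>\<^sub>p [:0, a:]) \<circ>\<^sub>p [:0, b:] = F \<circ>\<^sub>p [:0, a * b:]" for a b :: "'a :: comm_ring_1"
  by (simp add: pcompose_assoc[symmetric] pcompose_pCons mult.commute)

lemma sig_fixed:
  assumes "sig x = x"
  shows "x = of_int (c0 x)"
  using assms by (simp add: sig_def z5_eq_iff)

text \<open>The product \<open>P\<close> of the F(zeta^t X) is invariant under X -> zeta X, hence a
  polynomial in X^5, and its coefficients are fixed by the Galois generator, hence integers. Modulo
  \<open>lam\<close> all five factors equal F, so G(X^5) = F(X)^5 = F(X^5); for integers a
  congruence modulo \<open>lam\<close> is one modulo 5.\<close>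

lemma norm_poly_exists:
  fixes F :: "int poly"
  obtains G H where "G = F + smult 5 H"
    "\<And>z :: complex. (\<Prod>t<5. ieval F (om ^ t * z)) = ieval G (z ^ 5)"
proof -
  define F' :: "z5 poly" where "F' = map_poly of_int F"
  define A where "A t = F' \<circ>\<^sub>p [:0, zeta ^ t:]" for t
  define P where "P = (\<Prod>t<5. A t)"
  have A_mod: "A t = A (t mod 5)" for t unfolding A_def by (subst zeta_pow_mod) (rule refl)
  have P: "P = A 0 * A 1 * A 2 * A 3 * A 4"
    by (simp add: P_def lessThan_nat_numeral lessThan_Suc mult_ac)
  have "A t \<circ>\<^sub>p [:0, zeta:] = A (Suc t)" for t
    unfolding A_def pcompose_scale by (simp add: mult.commute)
  then have "P \<circ>\<^sub>p [:0, zeta:] = P"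
    using A_mod[of 5] by (simp add: P pcompose_mult mult_ac eval_nat_numeral)
  then have inv: "zeta ^ n * coeff P n = coeff P n" for n
    by (metis coeff_pcompose_linear)
  have coeff0: "coeff P n = 0" if "\<not> 5 dvd n" for n
  proof -
    have "zeta ^ n \<noteq> 1"
    proof -
      from that have "n mod 5 = 1 \<or> n mod 5 = 2 \<or> n mod 5 = 3 \<or> n mod 5 = 4" by presburger
      then show ?thesis unfolding zeta_pow_mod[of n] one_z5_def
        by (elim disjE; simp only: zeta_pows; simp)
    qed
    moreover have "(zeta ^ n - 1) * coeff P n = 0" using inv[of n] by (simp add: algebra_simps)
    ultimately show ?thesis by simp
  qed
  interpret sp: map_poly_comm_ring_hom sig ..
  have "map_poly sig (A t) = A (2 * t)" for t
  proof -
    have "map_poly sig F' = F'" unfolding F'_def by (rule ieval_hom_poly) unfold_locales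
    then show ?thesis
      by (simp add: A_def sig.map_poly_pcompose sig.map_poly_pCons_hom sig.hom_power sig_zeta power_mult)
  qed
  then have "map_poly sig P = P"
    using A_mod[of 6] A_mod[of 8] by (simp add: P sp.hom_mult mult_ac)
  then have "sig (coeff P n) = coeff P n" for n by (metis sig.coeff_map_poly_hom)
  then have cint: "coeff P n = of_int (c0 (coeff P n))" for n
    by (rule sig_fixed)
  define G where "G = (\<Sum>k\<le>degree P. monom (c0 (coeff P (5 * k))) k)"
  have cG: "coeff G k = c0 (coeff P (5 * k))" for k
  proof (cases "k \<le> degree P")
    case True
    then show ?thesis by (simp add: G_def coeff_sum)
  next
    case False
    then have "coeff P (5 * k) = 0" by (intro coeff_eq_0) simp
    then show ?thesis using False by (simp add: G_def coeff_sum)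
  qed
  have PG: "P = map_poly of_int G \<circ>\<^sub>p monom 1 5"
    by (rule poly_eqI) (auto simp: coeff_pcompose_monom5 cG coeff0 simp flip: cint)
  have "[:lam:] dvd A t - F'" for t
    unfolding const_poly_dvd_iff
  proof
    fix n
    have "lam dvd (zeta ^ (t * n) - 1) * coeff F' n" by (intro dvd_mult2 lam_dvd_zeta_pow)
    then show "lam dvd coeff (A t - F') n"
      by (simp add: A_def coeff_pcompose_linear algebra_simps flip: power_mult)
  qed
  then have P5: "[:lam:] dvd P - F' ^ 5" unfolding P_def by (rule dvd_prod_diff_power)
  have "5 dvd coeff (G - F) k" for k
  proof -
    have "lam dvd coeff P (5 * k) - coeff (F' ^ 5) (5 * k)"
      using P5 unfolding const_poly_dvd_iff by simp
    also have "F' ^ 5 = map_poly of_int (F ^ 5)" by (simp add: F'_def of_int_poly_hom.hom_power)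
    also have "coeff P (5 * k) - coeff \<dots> (5 * k) = of_int (coeff G k - coeff (F ^ 5) (5 * k))"
      unfolding cG using cint[of "5 * k"] by simp
    finally have 1: "5 dvd coeff G k - coeff (F ^ 5) (5 * k)" unfolding lam_dvd_of_int_iff .
    have "5 dvd coeff (F ^ 5) (5 * k) - coeff (F \<circ>\<^sub>p monom 1 5) (5 * k)"
      using pow5_cong[of F] unfolding const_poly_dvd_iff by simp
    then have "5 dvd coeff (F ^ 5) (5 * k) - coeff F k" by (simp add: coeff_pcompose_monom5)
    from dvd_add[OF 1 this] show ?thesis by simp
  qed
  then have "[:5:] dvd G - F" unfolding const_poly_dvd_iff by blast
  then obtain H where "G - F = [:5:] * H" by (elim dvdE)
  then have GH: "G = F + smult 5 H" by (simp add: algebra_simps)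
  have eom: "comm_ring_hom (emb om)" using emb_om[of 1] by simp
  interpret e: comm_ring_hom "emb om" by (rule eom)
  interpret ep: map_poly_comm_ring_hom "emb om" ..
  have "(\<Prod>t<5. ieval F (om ^ t * z)) = ieval G (z ^ 5)" for z :: complex
  proof -
    have "poly (map_poly (emb om) (A t)) z = ieval F (om ^ t * z)" for t
      unfolding A_def F'_def
      by (simp add: e.map_poly_pcompose ieval_hom_poly[OF eom] e.map_poly_pCons_hom e.hom_power poly_pcompose mult.commute)
    then have "(\<Prod>t<5. ieval F (om ^ t * z)) = poly (map_poly (emb om) P) z"
      by (simp add: P_def ep.hom_prod poly_prod)
    also have "\<dots> = ieval G (z ^ 5)"
      by (simp add: PG e.map_poly_pcompose ieval_hom_poly[OF eom] poly_pcompose poly_monom)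
    finally show ?thesis .
  qed
  with GH show thesis by (rule that)
qed

lemma ieval_cong_eps: "[eps (ieval F zeta) = poly F 1] (mod 5)"
proof -
  have "lam dvd ieval F zeta - of_int (poly F 1)"
  proof (induction F)
    case (pCons a F)
    have "ieval (pCons a F) zeta - of_int (poly (pCons a F) 1) =
      zeta * (ieval F zeta - of_int (poly F 1)) + lam * of_int (poly F 1)"
      by (simp add: of_int_hom.map_poly_pCons_hom lam_def algebra_simps)
    then show ?case using pCons.IH by (simp only: dvd_add dvd_mult dvd_triv_left)
  qed simp
  then show ?thesis by (simp add: lam_dvd_iff cong_iff_dvd_diff)
qed

lemma prod_om_powers:
  "(\<Prod>t<5. ieval F (om ^ t)) = of_int (poly F 1 * znorm (ieval F zeta))"
proof -
  have "(\<Prod>t<5. ieval F (om ^ t)) = ieval F 1 * (ieval F om * ieval F (om ^ 2) * ieval F (om ^ 3) * ieval F (om ^ 4))"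
    by (simp add: lessThan_nat_numeral lessThan_Suc mult_ac)
  also have "\<dots> = of_int (poly F 1) * of_int (znorm (ieval F zeta))"
    unfolding of_int_znorm
    using emb_ieval[of 1 F] emb_ieval[of 2 F] emb_ieval[of 3 F] emb_ieval[of 4 F] by simp
  finally show ?thesis by simp
qed

section \<open>Determinants divisible by 5\<close>

lemma prime_5_int: "prime (5 :: int)"
  by simp

lemma circ_det_cases:
  assumes "d \<in> circ_dets 25" "5 dvd d" "\<not> 5 ^ 4 dvd d"
  shows "\<exists>q m. d = 5 ^ 3 * q * m \<and> perissad q \<and> coprime m 5"
proof -
  obtain F where F: "of_int d = (\<Prod>i<5. \<Prod>t<5. ieval F (om ^ t * eta ^ i))"
    using assms(1) unfolding circ_dets_25_iff by blast
  obtain G H where G: "G = F + smult 5 H"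
    and GF: "\<And>z :: complex. (\<Prod>t<5. ieval F (om ^ t * z)) = ieval G (z ^ 5)"
    using norm_poly_exists[of F] by metis
  define f g x y h where "f = poly F 1" and "g = poly G 1" and "x = ieval F zeta"
    and "y = ieval G zeta" and "h = ieval H zeta"
  have "(eta ^ i) ^ 5 = om ^ i" for i
    by (simp add: eta_pow5[symmetric] mult.commute flip: power_mult)
  then have "of_int d = (\<Prod>i<5. ieval G (om ^ i))" unfolding F GF by simp
  then have "(of_int d :: complex) = of_int (g * znorm y)" unfolding prod_om_powers g_def y_def .
  then have d: "d = g * znorm y" by (simp only: of_int_eq_iff)
  have "(of_int g :: complex) = of_int (f * znorm x)"
    using GF[of 1] unfolding f_def g_def x_def prod_om_powers[symmetric] by simp
  then have g: "g = f * znorm x" by (simp only: of_int_eq_iff)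
  have gf: "g = f + 5 * poly H 1" by (simp add: g_def f_def G)
  have yx: "y = x + of_int 5 * h"
    unfolding y_def x_def h_def G by (simp add: of_int_hom.map_poly_hom_add of_int_hom.map_poly_hom_smult)
  have ex: "[eps x = f] (mod 5)" and eh: "[eps h = poly H 1] (mod 5)"
    unfolding x_def f_def h_def by (rule ieval_cong_eps)+
  have lx: "lam dvd x \<longleftrightarrow> 5 dvd f" unfolding lam_dvd_iff by (rule cong_dvd_iff[OF ex])
  have ly: "lam dvd y \<longleftrightarrow> lam dvd x"
    unfolding yx using lam_dvd_5 by (simp only: dvd_add_left_iff dvd_mult2)
  have "5 dvd f"
  proof -
    from assms(2) have "5 dvd f \<or> 5 dvd znorm x \<or> 5 dvd znorm y"
      unfolding d g prime_dvd_mult_iff[OF prime_5_int] by blast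
    then show ?thesis by (simp add: dvd_znorm_iff lx ly)
  qed
  then obtain a where a: "f = 5 * a" by (elim dvdE)
  from \<open>5 dvd f\<close> obtain x' where x': "x = lam * x'" using lx by (elim dvdE) auto
  obtain mu' where mu': "1 = mu * mu'" using mu_unit by (elim dvdE)
  define e where "e = mu' * h"
  have five: "of_int 5 = lam ^ 4 * mu'"
  proof -
    have "lam ^ 4 * mu' = of_int 5 * (mu * mu')" by (simp only: lam_pow4 mult.assoc)
    then show ?thesis by (simp flip: mu')
  qed
  define y' where "y' = x' + lam ^ 3 * e"
  have y': "y = lam * y'"
    unfolding yx x' five y'_def e_def by (simp add: eval_nat_numeral algebra_simps)
  \<comment> \<open>The factors f, znorm x and znorm y each contribute one 5; the cofactor is prime
    to 5 because \<open>5 ^ 4\<close> does not divide \<open>d\<close>.\<close>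
  have dd: "d = 5 ^ 3 * (a * znorm x' * znorm y')"
    by (simp add: d g a x' y' znorm_mult)
  have nd: "\<not> 5 dvd a * znorm x' * znorm y'"
  proof
    assume "5 dvd a * znorm x' * znorm y'"
    then have "5 ^ 3 * 5 dvd d" unfolding dd by (rule mult_dvd_mono[OF dvd_refl])
    with assms(3) show False by simp
  qed
  then have na: "\<not> 5 dvd a" and nx: "\<not> lam dvd x'" and ny: "\<not> lam dvd y'"
    by (auto simp flip: dvd_znorm_iff)
  \<comment> \<open>Compare values at 1: G(1) is a multiple of 25 while F(1) = 5 a, so H(1) is -a
    modulo 5, which is nonzero.\<close>
  have "5 * poly H 1 = 5 * (5 * (a * znorm x') - a)"
    using gf unfolding g a x' znorm_mult by (simp add: algebra_simps)
  then have "poly H 1 = 5 * (a * znorm x') - a" by simp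
  then have "\<not> 5 dvd poly H 1" using na by (simp add: dvd_diff_right_iff)
  then have nh: "\<not> lam dvd h" unfolding lam_dvd_iff cong_dvd_iff[OF eh] .
  have ne: "\<not> lam dvd e"
  proof
    assume "lam dvd e"
    then have "lam dvd mu * e" by (rule dvd_mult)
    also have "mu * e = h" unfolding e_def by (simp flip: mu' mult.assoc)
    finally show False using nh by simp
  qed
  have "\<exists>q. perissad q \<and> (q dvd znorm x' \<or> q dvd znorm y')"
    using not_good_shift[OF nx ne] good_if_no_perissad[OF nx] good_if_no_perissad[OF ny]
    unfolding y'_def by blast
  then obtain q where q: "perissad q" "q dvd a * znorm x' * znorm y'"
    by (metis dvd_mult dvd_mult2)
  then obtain m where m: "a * znorm x' * znorm y' = q * m" by (elim dvdE)
  have "\<not> 5 dvd m" using nd dvd_mult[of 5 m q] unfolding m by blast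
  then have "coprime m 5" using prime_imp_coprime[OF prime_5_int] coprime_commute by blast
  then show ?thesis using q(1) dd unfolding m by (auto simp: mult.assoc)
qed

section \<open>Realizing multiples of 125\<close>

lemma prod_om_shift: "(\<Prod>t<5. om ^ t * z - 1) = z ^ 5 - 1"
proof -
  \<comment> \<open>Pairing \<open>om\<close> with \<open>om ^ 4\<close> and \<open>om ^ 2\<close>
    with \<open>om ^ 3\<close> gives two quadratics whose middle coefficients are, up to sign, the
    two roots s and -1 - s of s^2 + s = 1.\<close>
  define s where "s = om + om ^ 4"
  have e1: "(w * z - 1) * (w ^ 4 * z - 1) = w ^ 5 * z ^ 2 - (w + w ^ 4) * z + 1"
    and e2: "(w ^ 2 * z - 1) * (w ^ 3 * z - 1) = w ^ 5 * z ^ 2 - (w ^ 2 + w ^ 3) * z + 1"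
    and e3: "(w + w ^ 4) * (w + w ^ 4) = w ^ 2 + 2 * w ^ 5 + w ^ 8" for w :: complex
    by (simp_all add: eval_nat_numeral algebra_simps)
  have "om ^ 2 + om ^ 3 - (- 1 - s) = 1 + om + om ^ 2 + om ^ 3 + om ^ 4" by (simp add: s_def)
  then have om23: "om ^ 2 + om ^ 3 = - 1 - s" unfolding om_cyclotomic by simp
  have "(\<Prod>t<5. om ^ t * z - 1) = (z - 1) * (om * z - 1) * (om ^ 2 * z - 1) * (om ^ 3 * z - 1) * (om ^ 4 * z - 1)"
    by (simp add: lessThan_nat_numeral lessThan_Suc mult_ac)
  also have "\<dots> = (z - 1) * ((om * z - 1) * (om ^ 4 * z - 1)) * ((om ^ 2 * z - 1) * (om ^ 3 * z - 1))"
    by (simp only: mult_ac)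
  also have "(om * z - 1) * (om ^ 4 * z - 1) = om ^ 5 * z ^ 2 - s * z + 1"
    unfolding s_def by (rule e1)
  also have "(om ^ 2 * z - 1) * (om ^ 3 * z - 1) = om ^ 5 * z ^ 2 - (om ^ 2 + om ^ 3) * z + 1"
    by (rule e2)
  also have "om ^ 2 + om ^ 3 = - 1 - s"
    by (rule om23)
  also have "(z - 1) * (om ^ 5 * z ^ 2 - s * z + 1) * (om ^ 5 * z ^ 2 - (- 1 - s) * z + 1) =
    z ^ 5 - 1 + (1 - s - s * s) * (z ^ 3 - z ^ 2)"
    unfolding om_pow5 by (simp add: eval_nat_numeral algebra_simps)
  also have "s * s = 1 - s"
  proof -
    have "s * s = om ^ 2 + 2 * om ^ 5 + om ^ 8" unfolding s_def by (rule e3)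
    also have "om ^ 8 = om ^ 3" using om_pow_mod[of 8] by simp
    also have "om ^ 2 + 2 * om ^ 5 + om ^ 3 = 1 - s"
      using om23 by (simp add: algebra_simps)
    finally show ?thesis .
  qed
  finally show ?thesis by simp
qed

definition cyc5 :: "int poly" where "cyc5 = [:1, 1, 1, 1, 1:]"

lemma ieval_cyc5: "ieval cyc5 z = 1 + z + z ^ 2 + z ^ 3 + z ^ 4"
  by (simp add: cyc5_def of_int_hom.map_poly_pCons_hom eval_nat_numeral algebra_simps)

text \<open>The cyclotomic factor in X^5 vanishes at the primitive 25th roots, where only X - 1
  remains, with product 5. At the fifth roots of unity it equals 5, so \<open>v\<close> freely
  adjusts the value at 1 and, by multiples of 5, the value at \<open>zeta\<close>.\<close>

lemma circ_det_construct:
  "5 * (5 * poly v 1) * znorm (lam + of_int 5 * ieval v zeta) \<in> circ_dets 25"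
proof -
  define F where "F = [:-1, 1:] + (cyc5 \<circ>\<^sub>p monom 1 5) * v"
  have F: "ieval F z = z - 1 + (1 + z ^ 5 + (z ^ 5) ^ 2 + (z ^ 5) ^ 3 + (z ^ 5) ^ 4) * ieval v z" for z :: complex
    unfolding F_def ieval_simps of_int_hom.map_poly_pcompose poly_pcompose ieval_cyc5
    by (simp add: of_int_hom.map_poly_pCons_hom poly_monom)
  have Fz: "ieval F zeta = lam + of_int 5 * ieval v zeta"
    unfolding F_def ieval_simps of_int_hom.map_poly_pcompose poly_pcompose ieval_cyc5
    by (simp add: of_int_hom.map_poly_pCons_hom poly_monom lam_def)
  have F1: "poly F 1 = 5 * poly v 1"
    by (simp add: F_def poly_pcompose poly_monom cyc5_def)
  have blk: "(\<Prod>t<5. ieval F (om ^ t * eta ^ i)) = om ^ i - 1" if "i \<in> {1, 2, 3, 4}" for i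
  proof -
    have "(eta ^ i) ^ 5 = om ^ i"
      by (simp add: eta_pow5[symmetric] mult.commute flip: power_mult)
    moreover have "(om ^ t) ^ 5 = 1" for t
    proof -
      have "(om ^ t) ^ 5 = (om ^ 5) ^ t" by (simp only: power_mult[symmetric] mult.commute)
      then show ?thesis by simp
    qed
    ultimately have z5: "(om ^ t * eta ^ i) ^ 5 = om ^ i" for t by (simp add: power_mult_distrib)
    have "ieval F (om ^ t * eta ^ i) = om ^ t * eta ^ i - 1" for t
      unfolding F z5 om_pow_cyclotomic[OF that] by simp
    then have "(\<Prod>t<5. ieval F (om ^ t * eta ^ i)) = (eta ^ i) ^ 5 - 1" by (simp add: prod_om_shift)
    then show ?thesis unfolding \<open>(eta ^ i) ^ 5 = om ^ i\<close> .
  qed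
  define B where "B i = (\<Prod>t<5. ieval F (om ^ t * eta ^ i))" for i
  have "(\<Prod>i<5. B i) = B 0 * (B 1 * B 2 * B 3 * B 4)"
    by (simp add: lessThan_nat_numeral lessThan_Suc mult_ac)
  also have "B 0 = (\<Prod>t<5. ieval F (om ^ t))" by (simp add: B_def)
  also have "B 1 * B 2 * B 3 * B 4 = (om ^ 1 - 1) * (om ^ 2 - 1) * (om ^ 3 - 1) * (om ^ 4 - 1)"
    using blk[of 1] blk[of 2] blk[of 3] blk[of 4] by (simp add: B_def del: prod.lessThan_Suc)
  also have "(om ^ 1 - 1) * (om ^ 2 - 1) * (om ^ 3 - 1) * (om ^ 4 - 1) = 5"
  proof -
    have "emb w lam = w - 1" for w by (simp add: emb_def lam_def zeta_def)
    then show ?thesis using of_int_znorm[of lam] by simp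
  qed
  finally have "of_int (5 * (5 * poly v 1) * znorm (lam + of_int 5 * ieval v zeta)) =
    (\<Prod>i<5. \<Prod>t<5. ieval F (om ^ t * eta ^ i))"
    unfolding B_def prod_om_powers F1 Fz by simp
  then show ?thesis unfolding circ_dets_25_iff by blast
qed

lemma circ_det_multiple_625: "5 ^ 4 dvd d \<Longrightarrow> d \<in> circ_dets 25"
proof -
  assume "5 ^ 4 dvd d"
  then obtain m where m: "d = 5 ^ 4 * m" by (elim dvdE)
  \<comment> \<open>A multiple of the cyclotomic polynomial leaves the value at \<open>zeta\<close>
    equal to \<open>lam\<close> and puts the whole factor m into the value at 1.\<close>
  have "ieval (smult m cyc5) zeta = 0"
    using zeta_cyclotomic by (simp add: of_int_hom.map_poly_hom_smult ieval_cyc5)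
  moreover have "poly (smult m cyc5) 1 = 5 * m" by (simp add: cyc5_def)
  ultimately have "5 * (5 * (5 * m)) * znorm (lam + of_int 5 * 0) \<in> circ_dets 25"
    using circ_det_construct[of "smult m cyc5"] by (simp only:)
  then show ?thesis by (simp add: m)
qed

text \<open>Applying \<open>sig\<close> keeps the norm and multiplies the residue of the coefficient
  of \<open>lam ^ 3\<close> by 2^3, because \<open>sig lam = lam * (1 + zeta)\<close>. As 8 = 3 is a
  primitive root modulo 5, the four conjugates realize all nonzero residues.\<close>

lemma perissad_conjugates:
  assumes "perissad q" "\<not> 5 dvd c"
  shows "\<exists>b. znorm (1 + lam ^ 3 * b) = q \<and> [eps b = c] (mod 5)"
proof -
  obtain h :: "int poly" where h: "\<not> 5 dvd poly h 1" "of_int q = Nnorm 5 1 (1 + [:-1, 1:] ^ 3 * h)"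
    using assms(1) unfolding perissad_def by blast
  define b0 where "b0 = ieval h zeta"
  have "ieval (1 + [:-1, 1:] ^ 3 * h) zeta = 1 + lam ^ 3 * b0"
    by (simp add: of_int_hom.map_poly_pCons_hom lam_def b0_def)
  then have "of_int q = (of_int (znorm (1 + lam ^ 3 * b0)) :: complex)"
    using h(2) by (simp only: Nnorm_znorm)
  then have n0: "znorm (1 + lam ^ 3 * b0) = q" by (simp only: of_int_eq_iff)
  have "[eps b0 = poly h 1] (mod 5)" unfolding b0_def by (rule ieval_cong_eps)
  then have e0: "\<not> 5 dvd eps b0" using h(1) cong_dvd_iff by blast
  have conj: "\<exists>b'. znorm (1 + lam ^ 3 * b') = q \<and> [eps b' = 3 * eps b] (mod 5)"
    if "znorm (1 + lam ^ 3 * b) = q" for b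
  proof (intro exI conjI)
    define b' where "b' = (1 + zeta) ^ 3 * sig b"
    have sl: "sig lam = lam * (1 + zeta)"
      by (simp add: lam_def sig_def zeta_def z5_ops)
    have "1 + lam ^ 3 * b' = sig (1 + lam ^ 3 * b)"
      by (simp add: b'_def sig.hom_add sig.hom_mult sig.hom_power sl power_mult_distrib mult_ac)
    then show "znorm (1 + lam ^ 3 * b') = q" using that by simp
    have "eps (1 + zeta) = 2" by (simp add: eps_def zeta_def)
    then have "[eps b' = 2 ^ 3 * eps b] (mod 5)"
      unfolding b'_def using eps_power[of "1 + zeta" 3]
      by (intro cong_trans[OF eps_mult] cong_mult eps_sig) simp
    also have "[2 ^ 3 * eps b = 3 * eps b] (mod 5)" 
    proof -
      have "3 * eps b - 2 ^ 3 * eps b = 5 * (- eps b)" by simp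
      then show ?thesis by (metis cong_iff_dvd_diff cong_sym dvd_triv_left)
    qed
    finally show "[eps b' = 3 * eps b] (mod 5)" .
  qed
  obtain b1 where b1: "znorm (1 + lam ^ 3 * b1) = q" "[eps b1 = 3 * eps b0] (mod 5)"
    using conj[OF n0] by blast
  obtain b2 where b2: "znorm (1 + lam ^ 3 * b2) = q" "[eps b2 = 3 * eps b1] (mod 5)"
    using conj[OF b1(1)] by blast
  obtain b3 where b3: "znorm (1 + lam ^ 3 * b3) = q" "[eps b3 = 3 * eps b2] (mod 5)"
    using conj[OF b2(1)] by blast
  have "[eps b0 = c] (mod 5) \<or> [eps b1 = c] (mod 5) \<or> [eps b2 = c] (mod 5) \<or> [eps b3 = c] (mod 5)"
  proof -
    have m: "x mod 5 = 3 * (y mod 5) mod 5" if "[x = 3 * y] (mod 5)" for x y :: int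
      using that by (simp only: cong_def mod_mult_right_eq)
    have r: "x mod 5 = 1 \<or> x mod 5 = 2 \<or> x mod 5 = 3 \<or> x mod 5 = 4" if "\<not> 5 dvd x" for x :: int
      using that by presburger
    show ?thesis using r[OF e0] r[OF assms(2)] unfolding cong_def m[OF b3(2)] m[OF b2(2)] m[OF b1(2)] by (elim disjE) simp_all
  qed
  then show ?thesis using n0 b1(1) b2(1) b3(1) by blast
qed

lemma circ_det_perissad:
  assumes "perissad q" "coprime m 5"
  shows "5 ^ 3 * q * m \<in> circ_dets 25"
proof -
  have m5: "\<not> 5 dvd m" using assms(2) using coprime_common_divisor[of m 5 5] by auto
  \<comment> \<open>The sign compensates \<open>eps mu = - 1\<close>: the values of \<open>v\<close>
    at \<open>zeta\<close> and at 1 must be compatible modulo \<open>lam\<close>, so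
    \<open>mu * b\<close> has to have residue m.\<close>
  then obtain b where b: "znorm (1 + lam ^ 3 * b) = q" "[eps b = - m] (mod 5)"
    using perissad_conjugates[OF assms(1), of "- m"] by auto
  have "eps mu = - 1" by (simp add: mu_def eps_def zeta_pows) (simp add: zeta_def)
  then have "[eps (mu * b) = (- 1) * (- m)] (mod 5)"
    using eps_mult[of mu b] b(2) by (metis cong_trans cong_mult cong_refl)
  then have "5 dvd m - eps (mu * b)" by (simp add: cong_iff_dvd_diff dvd_diff_commute)
  then obtain t where t: "m - eps (mu * b) = 5 * t" by (elim dvdE)
  \<comment> \<open>The second summand vanishes at \<open>zeta\<close> and corrects the value at 1
    by 5 t to exactly m.\<close>
  define v where "v = z5_poly (mu * b) + smult t cyc5"
  have v1: "poly v 1 = m" using t by (simp add: v_def poly_z5_poly_1 cyc5_def)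
  have "ieval v zeta = mu * b"
    using zeta_cyclotomic by (simp add: v_def of_int_hom.map_poly_hom_smult ieval_cyc5)
  then have "lam + of_int 5 * ieval v zeta = lam + lam ^ 4 * b"
    by (simp only: lam_pow4 mult.assoc)
  also have "\<dots> = lam * (1 + lam ^ 3 * b)" by (simp add: eval_nat_numeral algebra_simps)
  finally have "znorm (lam + of_int 5 * ieval v zeta) = 5 * q" by (simp add: znorm_mult b(1))
  then show ?thesis using circ_det_construct[of v] v1 by (simp add: mult_ac)
qed

section \<open>Determinants coprime to 5\<close>

lemma circ_det_uminus: "d \<in> circ_dets 25 \<Longrightarrow> - d \<in> circ_dets 25"
proof -
  assume "d \<in> circ_dets 25"
  then obtain F where "of_int d = (\<Prod>l<25. ieval F (cis (2 * pi / real 25) ^ l))"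
    using circ_dets_iff[of 25 d] by auto
  then have "of_int (- d) = (\<Prod>l<25. ieval (- F) (cis (2 * pi / real 25) ^ l))"
    by (simp add: of_int_poly_hom.hom_uminus prod.distrib prod_uminus)
  then show ?thesis using circ_dets_iff[of 25 "- d"] by auto
qed

text \<open>The polynomial (X^m - 1) / (X - 1) has value m at 1. Over the other 25th roots its
  values multiply to 1, because raising to the power m permutes these roots, so numerators and
  denominators have the same product.\<close>

lemma circ_det_coprime_nat:
  assumes "coprime m 25"
  shows "int m \<in> circ_dets 25"
proof -
  define F :: "int poly" where "F = (\<Sum>i<m. monom 1 i)"
  have F: "ieval F z = (\<Sum>i<m. z ^ i)" for z :: complex
    by (simp add: F_def of_int_poly_hom.hom_sum poly_sum poly_monom)
  have inj: "inj_on (\<lambda>k. eta ^ k) {..<25}"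
    using bij_betw_roots_unity[of 25] unfolding eta_def bij_betw_def by (simp add: DeMoivre mult_ac)
  have ne: "eta ^ j \<noteq> 1" if "j \<in> {1..<25}" for j
    using inj_onD[OF inj, of j 0] that by auto
  have bij: "bij_betw (\<lambda>j. j * m mod 25) {1..<25} {1..<25}"
  proof -
    have inj': "inj_on (\<lambda>j. j * m mod 25) {1..<25}"
    proof (rule inj_onI)
      fix i j assume ij: "i \<in> {1..<25}" "j \<in> {1..<25}" "i * m mod 25 = j * m mod 25"
      then have "[i * m = j * m] (mod 25)" by (simp add: cong_def)
      then have "[i = j] (mod 25)" using assms by (simp add: cong_mult_rcancel_nat coprime_commute)
      then show "i = j" using ij by (simp add: cong_def)
    qed
    have "(\<lambda>j. j * m mod 25) ` {1..<25} \<subseteq> {1..<25}"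
    proof safe
      fix j :: nat assume j: "j \<in> {1..<25}"
      have "j * m mod 25 \<noteq> 0"
      proof
        assume "j * m mod 25 = 0"
        then have "25 dvd j * m" by (simp add: dvd_eq_mod_eq_0)
        then have "25 dvd j" using assms by (simp add: coprime_dvd_mult_left_iff coprime_commute)
        then show False using j by (auto dest: dvd_imp_le)
      qed
      then show "j * m mod 25 \<in> {1..<25}" by simp
    qed
    then have "(\<lambda>j. j * m mod 25) ` {1..<25} = {1..<25}"
      using inj' by (intro endo_inj_surj) auto
    with inj' show ?thesis unfolding bij_betw_def by blast
  qed
  define Q where "Q = (\<Prod>j\<in>{1..<25}. eta ^ j - 1)"
  have Q: "Q \<noteq> 0" using ne by (auto simp: Q_def)
  have "ieval F (eta ^ j) * (eta ^ j - 1) = eta ^ (j * m mod 25) - 1" for j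
  proof -
    have "(eta ^ j - 1) * (\<Sum>i<m. (eta ^ j) ^ i) = (eta ^ j) ^ m - 1"
      by (rule power_diff_1_eq[symmetric])
    then show ?thesis unfolding F eta_pow_mod[of "j * m", symmetric] by (simp add: power_mult mult.commute)
  qed
  then have "(\<Prod>j\<in>{1..<25}. ieval F (eta ^ j)) * Q = (\<Prod>j\<in>{1..<25}. eta ^ (j * m mod 25) - 1)"
    unfolding Q_def by (simp flip: prod.distrib)
  also have "\<dots> = Q"
    unfolding Q_def by (rule prod.reindex_bij_betw[OF bij, of "\<lambda>k. eta ^ k - 1"])
  finally have 1: "(\<Prod>j\<in>{1..<25}. ieval F (eta ^ j)) = 1" using Q by simp
  have "{..<25::nat} = insert 0 {1..<25}" by auto
  then have "(\<Prod>j<25. ieval F (eta ^ j)) = ieval F (eta ^ 0) * (\<Prod>j\<in>{1..<25}. ieval F (eta ^ j))" by simp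
  also have "ieval F (eta ^ 0) = of_int (int m)" unfolding F by simp
  finally have "of_int (int m) = (\<Prod>j<25. ieval F (eta ^ j))" by (simp only: 1 mult_1_right)
  then show ?thesis using circ_dets_iff[of 25 "int m"] unfolding eta_def by auto
qed

lemma circ_det_coprime:
  assumes "coprime d 5"
  shows "d \<in> circ_dets 25"
proof -
  have "coprime \<bar>d\<bar> (5 ^ 2)"
    using assms by (simp only: coprime_power_right_iff coprime_abs_left_iff simp_thms)
  then have "coprime (int (nat \<bar>d\<bar>)) (int 25)" by simp
  then have "coprime (nat \<bar>d\<bar>) 25" by (simp only: coprime_int_iff)
  then have "\<bar>d\<bar> \<in> circ_dets 25" using circ_det_coprime_nat by fastforce
  then show ?thesis using circ_det_uminus[of "\<bar>d\<bar>"] by (cases "d \<ge> 0") auto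
qed

theorem theorem1p2:
  shows "circ_dets 25 =
           {d. coprime d 5}
         \<union> {d. 5 ^ 4 dvd d}
         \<union> {5 ^ 3 * q * m | q m. perissad q \<and> coprime m 5}"
proof (intro equalityI subsetI)
  fix d assume d: "d \<in> circ_dets 25"
  show "d \<in> {d. coprime d 5} \<union> {d. 5 ^ 4 dvd d} \<union> {5 ^ 3 * q * m | q m. perissad q \<and> coprime m 5}"
  proof (cases "5 dvd d")
    case True
    then show ?thesis using circ_det_cases[OF d] by blast
  next
    case False
    then have "coprime d 5" using prime_imp_coprime[OF prime_5_int] coprime_commute by blast
    then show ?thesis by blast
  qed
next
  fix d assume "d \<in> {d. coprime d 5} \<union> {d. 5 ^ 4 dvd d} \<union> {5 ^ 3 * q * m | q m. perissad q \<and> coprime m 5}"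
  then show "d \<in> circ_dets 25"
    using circ_det_coprime circ_det_multiple_625 circ_det_perissad by blast
qed

end
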